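(* Assume $X$ has infinite variation, i.e. $\sigma\neq0$ or $\int_{|x|\le1}|x|\nu(dx)=\infty$, and that $d_+\ge0$. Then $$\lim_{t\to T}\frac{1}{T-t}\Big(\frac{K}{b(t)}-1\Big)=+\infty.$$
   Context: Let $X$ be a real Lévy process with characteristic triplet $(\sigma^2,\gamma,\nu)$; $(\mathcal F_t)$ the usual augmentation of its natural filtration. Fix $T>0$, $K>0$, $r>0$, $\delta\ge0$. Assume $\int_{|x|\ge1}e^x\nu(dx)<\infty$ and $\frac{\sigma^2}{2}+\gamma+\int(e^x-1-x\mathbf 1_{|x|\le1})\nu(dx)=0$, and the non-degeneracy condition: $\sigma\neq0$, or $\nu((-\infty,0))>0$, or $\int_{(0,\infty)}(x\wedge1)\nu(dx)=\infty$. For $x\ge0$ let $S^x_t=xe^{(r-\delta)t+X_t}$; $P(t,x)=\sup_{\tau\in\mathcal T_{0,T-t}}\mathbb E[e^{-r\tau}(K-S^x_\tau)_+]$ (American put, $\mathcal T_{0,s}$ = stopping times in $[0,s]$), and $b(t)=\inf\{x\ge0:P(t,x)>(K-x)_+\}$, $t\in[0,T)$, its critical price. Let $d_+=r-\delta-\int(e^y-1)_+\nu(dy)$. *)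

theory Defs
  imports "HOL-Probability.Probability"
begin

definition levy_measure :: "real measure \<Rightarrow> bool" where
  "levy_measure \<nu> \<longleftrightarrow> sets \<nu> = sets borel \<and> emeasure \<nu> {0} = 0 \<and>
     (\<integral>\<^sup>+ x. ennreal (min 1 (x\<^sup>2)) \<partial>\<nu>) < \<infinity>"

definition levy_exponent :: "real \<Rightarrow> real \<Rightarrow> real measure \<Rightarrow> real \<Rightarrow> complex" where
  "levy_exponent \<sigma> \<gamma> \<nu> u =
     - complex_of_real (\<sigma>\<^sup>2 * u\<^sup>2 / 2) + \<i> * complex_of_real (\<gamma> * u)
     + (CLINT x|\<nu>. iexp (u * x) - 1 - \<i> * complex_of_real (u * x * indicator {-1..1} x))"

definition levy_process ::
  "'a measure \<Rightarrow> (real \<Rightarrow> 'a \<Rightarrow> real) \<Rightarrow> real \<Rightarrow> real \<Rightarrow> real measure \<Rightarrow> bool" where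
  "levy_process M X \<sigma> \<gamma> \<nu> \<longleftrightarrow>
     prob_space M \<and> levy_measure \<nu> \<and>
     (\<forall>t. X t \<in> borel_measurable M) \<and>
     (\<forall>\<omega>\<in>space M. X 0 \<omega> = 0) \<and>
     (AE \<omega> in M. (\<forall>t\<ge>0. continuous (at_right t) (\<lambda>s. X s \<omega>)) \<and>
                   (\<forall>t>0. \<exists>l. ((\<lambda>s. X s \<omega>) \<longlongrightarrow> l) (at_left t))) \<and>
     (\<forall>(n::nat) (tt::nat \<Rightarrow> real). tt 0 \<ge> 0 \<longrightarrow> (\<forall>i<n. tt i < tt (Suc i)) \<longrightarrow>
        prob_space.indep_vars M (\<lambda>_. borel) (\<lambda>i \<omega>. X (tt (Suc i)) \<omega> - X (tt i) \<omega>) {..<n}) \<and>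
     (\<forall>s t. 0 \<le> s \<longrightarrow> 0 \<le> t \<longrightarrow>
        distr M borel (\<lambda>\<omega>. X (s + t) \<omega> - X s \<omega>) = distr M borel (X t)) \<and>
     (\<forall>t\<ge>0. \<forall>u. char (distr M borel (X t)) u = exp (complex_of_real t * levy_exponent \<sigma> \<gamma> \<nu> u))"

definition natural_filtration :: "'a measure \<Rightarrow> (real \<Rightarrow> 'a \<Rightarrow> real) \<Rightarrow> real \<Rightarrow> 'a set set" where
  "natural_filtration M X t =
     sigma_sets (space M) {X s -` B \<inter> space M | s B. 0 \<le> s \<and> s \<le> t \<and> B \<in> sets borel}"

definition aug_null_sets :: "'a measure \<Rightarrow> 'a set set" where
  "aug_null_sets M = {A. A \<subseteq> space M \<and> (\<exists>N\<in>null_sets M. A \<subseteq> N)}"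

definition usual_augmentation :: "'a measure \<Rightarrow> (real \<Rightarrow> 'a \<Rightarrow> real) \<Rightarrow> real \<Rightarrow> 'a set set" where
  "usual_augmentation M X t =
     (\<Inter>u\<in>{t<..}. sigma_sets (space M) (natural_filtration M X u \<union> aug_null_sets M))"

definition stopping_times_upto :: "'a measure \<Rightarrow> (real \<Rightarrow> 'a \<Rightarrow> real) \<Rightarrow> real \<Rightarrow> ('a \<Rightarrow> real) set" where
  "stopping_times_upto M X s = {\<tau>. (\<forall>\<omega>\<in>space M. 0 \<le> \<tau> \<omega> \<and> \<tau> \<omega> \<le> s) \<and>
       (\<forall>t\<ge>0. {\<omega>\<in>space M. \<tau> \<omega> \<le> t} \<in> usual_augmentation M X t)}"

text \<open>Expectations are taken in the completion of M (which contains the augmented filtration).\<close>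
definition american_put ::
  "'a measure \<Rightarrow> (real \<Rightarrow> 'a \<Rightarrow> real) \<Rightarrow> real \<Rightarrow> real \<Rightarrow> real \<Rightarrow> real \<Rightarrow> real \<Rightarrow> real \<Rightarrow> real" where
  "american_put M X r \<delta> K T t x =
     Sup ((\<lambda>\<tau>. \<integral>\<omega>. exp (- r * \<tau> \<omega>) * max 0 (K - x * exp ((r - \<delta>) * \<tau> \<omega> + X (\<tau> \<omega>) \<omega>))
                 \<partial>completion M) ` stopping_times_upto M X (T - t))"

definition critical_price ::
  "'a measure \<Rightarrow> (real \<Rightarrow> 'a \<Rightarrow> real) \<Rightarrow> real \<Rightarrow> real \<Rightarrow> real \<Rightarrow> real \<Rightarrow> real \<Rightarrow> real" where
  "critical_price M X r \<delta> K T t = Inf {x. 0 \<le> x \<and> american_put M X r \<delta> K T t x > max 0 (K - x)}"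

definition d_plus :: "real \<Rightarrow> real \<Rightarrow> real measure \<Rightarrow> ereal" where
  "d_plus r \<delta> \<nu> = ereal (r - \<delta>) - enn2ereal (\<integral>\<^sup>+ y. ennreal (max 0 (exp y - 1)) \<partial>\<nu>)"

end

theory Submission
  imports Defs
begin

text \<open>
  Write \<open>s = T - t\<close>. For the upper bound on \<open>b(t)\<close> it suffices to compare with the European put:
  at \<open>x = K / (1 + C s)\<close> the intrinsic value is at most \<open>K C s\<close>, while
  \<open>E (1 - exp (r s + X\<^sub>s))\<^sub>+ / s\<close> tends to infinity. If \<open>\<sigma> \<noteq> 0\<close> this holds because \<open>X\<^sub>s / (\<bar>\<sigma>\<bar> sqrt s)\<close>
  is asymptotically standard normal; otherwise \<open>d\<^sub>+ \<ge> 0\<close> forces the negative jumps to have infinite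
  variation, and \<open>E f(X\<^sub>s) / s\<close> tends to the \<open>\<nu>\<close>-integral of \<open>f\<close> for continuous \<open>f \<ge> 0\<close> supported in
  \<open>[-2, -\<epsilon>]\<close>, by the continuity theorem for the laws of \<open>X\<^sub>s\<close> reweighted by \<open>1 - cos x\<close>.

  As \<open>K / 0 = 0\<close> in HOL, one also needs \<open>b(t) > 0\<close>, i.e. that immediate exercise is optimal
  for small \<open>x\<close>. The function \<open>\<phi>(y) = exp (y - y\<^sup>2 / 2)\<close> is bounded, lies below \<open>exp y\<close> and equals it at
  \<open>0\<close>; being a Gaussian, its Fourier representation gives \<open>E \<phi>(y + X\<^sub>h) \<ge> \<phi>(y) - C h\<close> uniformly in \<open>y\<close>, hence
  \<open>E \<phi>(X\<^sub>\<tau>) \<ge> 1 - C E \<tau>\<close> for every stopping time \<open>\<tau>\<close>. Thus waiting gains at most \<open>x C' E \<tau>\<close>, less than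
  the interest of order \<open>r K E \<tau>\<close> that is lost.
\<close>

section \<open>Elementary estimates for the exponential and a Gaussian tail\<close>

text \<open>The derivative of \<open>exp\<close> has modulus at most 1 on the closed left
  half-plane, which is convex, so \<open>exp\<close> is 1-Lipschitz there; compare \<open>z\<close>
  with 0.\<close>

lemma norm_exp_minus_1_le:
  fixes z :: complex
  assumes "Re z \<le> 0"
  shows "norm (exp z - 1) \<le> norm z"
proof -
  have "norm (exp z - exp 0) \<le> 1 * norm (z - 0)"
  proof (rule field_differentiable_bound[where S = "{z. Re z \<le> 0}" and f' = exp])
    show "convex {z. Re z \<le> 0}"
      using convex_halfspace_Re_le[of 0] by simp
  qed (use assms in \<open>auto intro!: DERIV_subset[OF DERIV_exp] simp: norm_exp_eq_Re\<close>)
  then show ?thesis by simp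
qed

text \<open>On a bounded interval the concave payoff \<open>1 - exp y\<close> dominates a line
  through the origin. This lets piecewise linear test functions stand in for the put payoff, at the
  cost of the factor \<open>1 + c\<close>.\<close>

lemma one_minus_exp_ge:
  fixes y :: real
  assumes "-c \<le> y" "y \<le> 0"
  shows "1 - exp y \<ge> - y / (1 + c)"
proof -
  have "exp y \<le> 1 / (1 - y)"
    using exp_ge_add_one_self[of "-y"] assms by (simp add: exp_minus field_simps)
  then have "1 - exp y \<ge> - y / (1 - y)"
    using assms by (simp add: field_simps)
  moreover have "- y / (1 - y) \<ge> - y / (1 + c)"
    using assms by (intro divide_left_mono mult_pos_pos) auto
  ultimately show ?thesis by linarith
qed

text \<open>The integrand is positive on (-3,-2), which has positive Lebesgue measure. The value
  serves as the limiting constant in the Gaussian case.\<close>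

lemma std_normal_left_tail_pos:
  "0 < (\<integral>x. max 0 (min 1 (- x - 1)) \<partial>std_normal_distribution)"
proof -
  interpret N: real_distribution std_normal_distribution
    by (rule real_dist_normal_dist)
  let ?f = "\<lambda>x::real. max 0 (min 1 (- x - 1))"
  have int: "integrable std_normal_distribution ?f"
    by (rule N.integrable_const_bound[where B = 1]) auto
  have "(\<integral>x. ?f x \<partial>std_normal_distribution) \<noteq> 0"
  proof
    assume "(\<integral>x. ?f x \<partial>std_normal_distribution) = 0"
    then have "AE x in std_normal_distribution. ?f x = 0"
      using integral_nonneg_eq_0_iff_AE[OF int] by auto
    then have "AE x in lborel. \<not> (-3 < x \<and> x < (-2::real))"
      by (subst (asm) AE_density) (auto simp: normal_density_pos elim!: eventually_mono)
    then have "emeasure lborel {-3<..<-2::real} = 0"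
      by (subst (asm) AE_iff_measurable[of "{-3<..<-2}"]) auto
    then show False by simp
  qed
  moreover have "(\<integral>x. ?f x \<partial>std_normal_distribution) \<ge> 0"
    by (intro integral_nonneg_AE) auto
  ultimately show ?thesis by linarith
qed

section \<open>The Levy exponent\<close>

locale levy =
  fixes M :: "'a measure" and X :: "real \<Rightarrow> 'a \<Rightarrow> real"
    and \<sigma> \<gamma> :: real and \<nu> :: "real measure"
  assumes levy_process: "levy_process M X \<sigma> \<gamma> \<nu>"
begin

sublocale prob_space M
  using levy_process by (simp add: levy_process_def)

lemma sets_nu [simp, measurable_cong]: "sets \<nu> = sets borel"
  and nu_min_finite: "(\<integral>\<^sup>+ x. ennreal (min 1 (x\<^sup>2)) \<partial>\<nu>) < \<infinity>"
  using levy_process by (auto simp: levy_process_def levy_measure_def)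

lemma X_measurable [measurable]: "X t \<in> borel_measurable M"
  using levy_process by (auto simp: levy_process_def)

lemma X_0: "\<omega> \<in> space M \<Longrightarrow> X 0 \<omega> = 0"
  using levy_process by (auto simp: levy_process_def)

lemma X_right_continuous: "AE \<omega> in M. \<forall>t\<ge>0. continuous (at_right t) (\<lambda>s. X s \<omega>)"
  using levy_process by (auto simp: levy_process_def)

lemma increments_indep:
  "tt 0 \<ge> 0 \<Longrightarrow> (\<And>i. i < n \<Longrightarrow> tt i < tt (Suc i)) \<Longrightarrow>
    indep_vars (\<lambda>_. borel) (\<lambda>i \<omega>. X (tt (Suc i)) \<omega> - X (tt i) \<omega>) {..<n::nat}"
  using levy_process by (auto simp: levy_process_def)

lemma increments_stationary:
  "0 \<le> s \<Longrightarrow> 0 \<le> t \<Longrightarrow> distr M borel (\<lambda>\<omega>. X (s + t) \<omega> - X s \<omega>) = distr M borel (X t)"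
  using levy_process by (auto simp: levy_process_def)

abbreviation "\<psi> \<equiv> levy_exponent \<sigma> \<gamma> \<nu>"

lemma char_X: "0 \<le> t \<Longrightarrow> char (distr M borel (X t)) u = exp (complex_of_real t * \<psi> u)"
  using levy_process by (auto simp: levy_process_def)

lemma integrable_nu_min: "integrable \<nu> (\<lambda>x. min 1 (x\<^sup>2))"
  using nu_min_finite by (intro integrableI_nonneg) auto

lemma integrable_nu_bound:
  fixes f :: "real \<Rightarrow> 'b::{banach, second_countable_topology}"
  assumes [measurable]: "f \<in> borel_measurable borel" and "\<And>x. norm (f x) \<le> c * min 1 (x\<^sup>2)"
  shows "integrable \<nu> f"
  by (rule Bochner_Integration.integrable_bound[of _ "\<lambda>x. c * min 1 (x\<^sup>2)"])
     (use assms(2) in \<open>auto simp: integrable_nu_min intro!: AE_I2 order_trans[OF _ abs_ge_self]\<close>)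

abbreviation levy_integrand :: "real \<Rightarrow> real \<Rightarrow> complex" where
  "levy_integrand u x \<equiv> iexp (u * x) - 1 - \<i> * complex_of_real (u * x * indicator {-1..1} x)"

text \<open>For |x| \<le> 1 the compensator makes this a second-order Taylor remainder, at most u^2
  x^2 / 2; for |x| > 1 there is no compensator and the modulus is at most 2. The bound shows the
  growth in \<open>u\<close> and the integrability in \<open>x\<close> at once.\<close>

lemma norm_levy_integrand_le: "norm (levy_integrand u x) \<le> (2 + u\<^sup>2) * min 1 (x\<^sup>2)"
proof (cases "x \<in> {-1..1}")
  case True
  then have x2: "x\<^sup>2 \<le> 1"
    by (simp add: abs_square_le_1 abs_le_iff)
  have "norm (levy_integrand u x) = norm (iexp (u * x) - (\<Sum>k\<le>1. (\<i> * complex_of_real (u * x))^k / fact k))"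
    using True by (simp add: algebra_simps)
  also have "\<dots> \<le> \<bar>u * x\<bar> ^ Suc 1 / fact (Suc 1)"
    by (rule iexp_approx1)
  also have "\<dots> = u\<^sup>2 * x\<^sup>2 / 2"
    by (simp add: numeral_2_eq_2[symmetric] power_mult_distrib)
  also have "\<dots> \<le> (2 + u\<^sup>2) * x\<^sup>2"
    by (simp add: algebra_simps)
  finally show ?thesis
    using x2 by (simp add: min_absorb2)
next
  case False
  then have "\<not> \<bar>x\<bar> \<le> 1" by (auto simp: abs_le_iff)
  then have x2: "1 \<le> x\<^sup>2"
    by (simp add: abs_square_le_1[symmetric])
  have "norm (levy_integrand u x) \<le> norm (iexp (u * x)) + norm (1::complex)"
    using False norm_triangle_ineq4[of "iexp (u * x)" 1] by (auto simp del: norm_exp_i_times norm_exp_eq_Re)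
  also have "\<dots> \<le> 2 + u\<^sup>2"
    by (simp del: of_real_mult)
  finally show ?thesis
    using x2 by (simp add: min_absorb1)
qed

lemma integrable_levy_integrand: "integrable \<nu> (levy_integrand u)"
  by (rule integrable_nu_bound[OF _ norm_levy_integrand_le]) measurable

text \<open>A characteristic function has modulus at most 1, and at time 1 this modulus is exp (Re
  \<psi>).\<close>

lemma Re_exponent_le_0: "Re (\<psi> u) \<le> 0"
proof -
  interpret D: real_distribution "distr M borel (X 1)" by simp
  have "norm (char (distr M borel (X 1)) u) \<le> 1"
    by (rule D.cmod_char_le_1)
  then show ?thesis
    by (simp add: char_X norm_exp_eq_Re)
qed

lemma norm_exponent_bound: "\<exists>C\<ge>0. \<forall>u. norm (\<psi> u) \<le> C * (1 + u\<^sup>2)"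
proof -
  define m where "m = (\<integral>x. min 1 (x\<^sup>2) \<partial>\<nu>)"
  have m0: "0 \<le> m"
    unfolding m_def by (intro integral_nonneg_AE AE_I2) auto
  have "norm (\<psi> u) \<le> (\<sigma>\<^sup>2 + \<bar>\<gamma>\<bar> + 2 * m) * (1 + u\<^sup>2)" for u
  proof -
    have "norm (CLINT x|\<nu>. levy_integrand u x) \<le> (\<integral>x. norm (levy_integrand u x) \<partial>\<nu>)"
      by (rule integral_norm_bound)
    also have "\<dots> \<le> (\<integral>x. (2 + u\<^sup>2) * min 1 (x\<^sup>2) \<partial>\<nu>)"
      by (intro integral_mono integrable_norm integrable_levy_integrand norm_levy_integrand_le
          integrable_mult_right integrable_nu_min)
    also have "\<dots> = (2 + u\<^sup>2) * m"
      by (simp add: m_def)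
    finally have 1: "norm (CLINT x|\<nu>. levy_integrand u x) \<le> (2 + u\<^sup>2) * m" .
    have 2: "\<bar>u\<bar> \<le> 1 + u\<^sup>2"
      using zero_le_power2[of "\<bar>u\<bar> - 1"] by (simp add: power2_eq_square algebra_simps)
    have "norm (\<psi> u) \<le> norm (complex_of_real (\<sigma>\<^sup>2 * u\<^sup>2 / 2)) + norm (\<i> * complex_of_real (\<gamma> * u))
        + norm (CLINT x|\<nu>. levy_integrand u x)"
      unfolding levy_exponent_def
      using norm_triangle_ineq[of "- complex_of_real (\<sigma>\<^sup>2 * u\<^sup>2 / 2)" "\<i> * complex_of_real (\<gamma> * u)"]
      by (intro order_trans[OF norm_triangle_ineq] add_mono order_refl) (simp only: norm_minus_cancel)
    also have "\<dots> \<le> \<sigma>\<^sup>2 * u\<^sup>2 / 2 + \<bar>\<gamma>\<bar> * (1 + u\<^sup>2) + (2 + u\<^sup>2) * m"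
      using mult_left_mono[OF 2, of "\<bar>\<gamma>\<bar>"] 1 by (simp add: norm_mult abs_mult norm_divide norm_power)
    also have "\<dots> \<le> (\<sigma>\<^sup>2 + \<bar>\<gamma>\<bar> + 2 * m) * (1 + u\<^sup>2)"
      using m0 by (simp add: algebra_simps)
    finally show ?thesis .
  qed
  then show ?thesis
    using m0 by (intro exI[of _ "\<sigma>\<^sup>2 + \<bar>\<gamma>\<bar> + 2 * m"]) auto
qed

text \<open>Since Re (h \<psi>) \<le> 0, |exp (h \<psi>) - 1| is at most h |\<psi>|, and \<psi>
  grows at most quadratically. Linearity in \<open>h\<close>, with a weight integrable under a
  Gaussian law in \<open>u\<close>, is what the one-step bound for the bump uses.\<close>

lemma char_minus_1_bound:
  "\<exists>C\<ge>0. \<forall>h\<ge>0. \<forall>u. norm (char (distr M borel (X h)) u - 1) \<le> C * h * (1 + u\<^sup>2)"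
proof -
  obtain C where C: "C \<ge> 0" "\<And>u. norm (\<psi> u) \<le> C * (1 + u\<^sup>2)"
    using norm_exponent_bound by auto
  have "norm (char (distr M borel (X h)) u - 1) \<le> C * h * (1 + u\<^sup>2)" if "h \<ge> 0" for h u
  proof -
    have "norm (char (distr M borel (X h)) u - 1) \<le> norm (complex_of_real h * \<psi> u)"
      unfolding char_X[OF that] using that Re_exponent_le_0[of u]
      by (intro norm_exp_minus_1_le) (simp add: mult_nonneg_nonpos)
    also have "\<dots> \<le> h * (C * (1 + u\<^sup>2))"
      using that C by (simp add: norm_mult mult_left_mono)
    finally show ?thesis by (simp add: algebra_simps)
  qed
  then show ?thesis using C(1) by blast
qed

section \<open>Small-time asymptotics of the put\<close>

text \<open>At the scaled frequency \<open>v n\<close> the Gaussian term of s \<psi>(v) is exactly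
  -u^2/2, the drift term vanishes with s v, and the jump term vanishes by dominated
  convergence.\<close>

lemma char_scaled_tendsto:
  fixes s :: "nat \<Rightarrow> real"
  assumes s: "\<And>n. 0 < s n" "s \<longlonglongrightarrow> 0" and \<sigma>: "\<sigma> \<noteq> 0"
  shows "(\<lambda>n. char (distr M borel (\<lambda>\<omega>. X (s n) \<omega> / (\<bar>\<sigma>\<bar> * sqrt (s n)))) u)
           \<longlonglongrightarrow> char std_normal_distribution u"
proof -
  define v where "v n = u / (\<bar>\<sigma>\<bar> * sqrt (s n))" for n
  have v2: "s n * (v n)\<^sup>2 = u\<^sup>2 / \<sigma>\<^sup>2" for n
    using s(1)[of n] by (simp add: v_def power_divide power_mult_distrib)
  have sv: "(\<lambda>n. s n * v n) \<longlonglongrightarrow> 0"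
  proof -
    have "s n * v n = sqrt (s n) * (u / \<bar>\<sigma>\<bar>)" for n
      using s(1)[of n] \<sigma> by (simp add: v_def field_simps)
    moreover have "(\<lambda>n. sqrt (s n) * (u / \<bar>\<sigma>\<bar>)) \<longlonglongrightarrow> sqrt 0 * (u / \<bar>\<sigma>\<bar>)"
      by (intro tendsto_intros s)
    ultimately show ?thesis by simp
  qed
  have char: "char (distr M borel (\<lambda>\<omega>. X (s n) \<omega> / (\<bar>\<sigma>\<bar> * sqrt (s n)))) u = exp (s n * \<psi> (v n))" for n
  proof -
    have "char (distr M borel (\<lambda>\<omega>. X (s n) \<omega> / (\<bar>\<sigma>\<bar> * sqrt (s n)))) u = char (distr M borel (X (s n))) (v n)"
      by (simp add: char_def integral_distr v_def)
    then show ?thesis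
      using s(1)[of n] by (simp add: char_X less_imp_le)
  qed
  obtain B where B: "\<And>n. \<bar>s n\<bar> \<le> B"
    using s(2) convergent_imp_Bseq[of s] unfolding Bseq_def convergent_def by auto
  \<comment> \<open>The majorant works because s (2 + v^2) = 2 s + u^2 / \<sigma>^2 stays bounded
    along the sequence.\<close>
  have J: "(\<lambda>n. CLINT x|\<nu>. s n * levy_integrand (v n) x) \<longlonglongrightarrow> (CLINT x|\<nu>. 0)"
  proof (rule integral_dominated_convergence)
    show "integrable \<nu> (\<lambda>x. (2 * B + u\<^sup>2 / \<sigma>\<^sup>2) * min 1 (x\<^sup>2))"
      by (intro integrable_mult_right integrable_nu_min)
    show "AE x in \<nu>. norm (complex_of_real (s n) * levy_integrand (v n) x) \<le> (2 * B + u\<^sup>2 / \<sigma>\<^sup>2) * min 1 (x\<^sup>2)" for n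
    proof (rule AE_I2)
      fix x
      have "norm (complex_of_real (s n) * levy_integrand (v n) x) \<le> s n * ((2 + (v n)\<^sup>2) * min 1 (x\<^sup>2))"
        unfolding norm_mult using s(1)[of n] norm_levy_integrand_le[of "v n" x] by (simp add: mult_left_mono)
      also have "\<dots> = (2 * s n + s n * (v n)\<^sup>2) * min 1 (x\<^sup>2)"
        by (simp add: algebra_simps)
      also have "\<dots> \<le> (2 * B + u\<^sup>2 / \<sigma>\<^sup>2) * min 1 (x\<^sup>2)"
        unfolding v2 using B[of n] by (intro mult_right_mono) auto
      finally show "norm (complex_of_real (s n) * levy_integrand (v n) x) \<le> (2 * B + u\<^sup>2 / \<sigma>\<^sup>2) * min 1 (x\<^sup>2)" .
    qed
    show "AE x in \<nu>. (\<lambda>n. complex_of_real (s n) * levy_integrand (v n) x) \<longlonglongrightarrow> 0"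
    proof (rule AE_I2)
      fix x
      \<comment> \<open>This second bound, linear in |x|, need not be integrable, but for fixed
        \<open>x\<close> it tends to 0 and so gives the pointwise limit.\<close>
      have bd: "norm (complex_of_real (s n) * levy_integrand (v n) x) \<le> 2 * s n + \<bar>s n * v n\<bar> * \<bar>x\<bar>" for n
      proof -
        have "norm (levy_integrand (v n) x) \<le> norm (iexp (v n * x)) + norm (1::complex) + norm (\<i> * complex_of_real (v n * x * indicator {-1..1} x))"
          by (intro order_trans[OF norm_triangle_ineq4] add_mono order_refl)
        also have "\<dots> \<le> 2 + \<bar>v n\<bar> * \<bar>x\<bar>"
          by (auto simp: norm_mult indicator_def abs_mult simp del: of_real_mult)
        finally have "s n * norm (levy_integrand (v n) x) \<le> s n * (2 + \<bar>v n\<bar> * \<bar>x\<bar>)"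
          using s(1)[of n] by (intro mult_left_mono) auto
        then show ?thesis
          unfolding norm_mult using s(1)[of n] by (simp add: abs_mult algebra_simps)
      qed
      have "(\<lambda>n. 2 * s n + \<bar>s n * v n\<bar> * \<bar>x\<bar>) \<longlonglongrightarrow> 2 * 0 + \<bar>0\<bar> * \<bar>x\<bar>"
        by (intro tendsto_intros s sv)
      then have lim: "(\<lambda>n. 2 * s n + \<bar>s n * v n\<bar> * \<bar>x\<bar>) \<longlonglongrightarrow> 0"
        by simp
      show "(\<lambda>n. complex_of_real (s n) * levy_integrand (v n) x) \<longlonglongrightarrow> 0"
        by (rule Lim_null_comparison[OF always_eventually lim]) (intro allI bd)
    qed
  qed measurable
  have "(\<lambda>n. s n * \<psi> (v n)) \<longlonglongrightarrow> complex_of_real (- (u\<^sup>2) / 2)"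
  proof -
    have "s n * \<psi> (v n) = complex_of_real (- (u\<^sup>2) / 2) + \<i> * complex_of_real (\<gamma> * (s n * v n))
        + (CLINT x|\<nu>. s n * levy_integrand (v n) x)" for n
    proof -
      have "complex_of_real (s n) * complex_of_real (\<sigma>\<^sup>2 * (v n)\<^sup>2 / 2) = complex_of_real (u\<^sup>2 / 2)"
        unfolding of_real_mult[symmetric] using v2[of n] \<sigma>
        by (intro arg_cong[where f = complex_of_real]) (simp add: field_simps)
      moreover have "(CLINT x|\<nu>. s n * levy_integrand (v n) x) = s n * (CLINT x|\<nu>. levy_integrand (v n) x)"
        by (rule integral_mult_right_zero)
      ultimately show ?thesis
        unfolding levy_exponent_def by (simp add: ring_distribs del: of_real_divide of_real_power)
    qed
    moreover have "(\<lambda>n. complex_of_real (- (u\<^sup>2) / 2) + \<i> * complex_of_real (\<gamma> * (s n * v n))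
        + (CLINT x|\<nu>. s n * levy_integrand (v n) x)) \<longlonglongrightarrow>
        complex_of_real (- (u\<^sup>2) / 2) + \<i> * complex_of_real (\<gamma> * 0) + (CLINT x|\<nu>. 0)"
      by (intro tendsto_intros sv J)
    ultimately show ?thesis by simp
  qed
  then have "(\<lambda>n. exp (s n * \<psi> (v n))) \<longlonglongrightarrow> exp (complex_of_real (- (u\<^sup>2) / 2))"
    by (rule tendsto_exp)
  then show ?thesis
    unfolding char char_std_normal_distribution exp_of_real .
qed

lemma integrable_X_bounded:
  assumes "f \<in> borel_measurable borel" "\<And>x::real. \<bar>f x\<bar> \<le> (B::real)"
  shows "integrable M (\<lambda>\<omega>. f (X s \<omega>))"
  using assms by (intro integrable_const_bound[where B = B]) auto

text \<open>The payoff dominates a tent-like function of X / q with q = |\<sigma>| sqrt s, times q /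
  2. Weak convergence of the scaled law makes its expectation exceed q c / 4, which is of order sqrt
  s and so eventually exceeds Z s.\<close>

lemma small_time_put_gaussian:
  fixes s :: "nat \<Rightarrow> real"
  assumes s: "\<And>n. 0 < s n" "s \<longlonglongrightarrow> 0" and \<sigma>: "\<sigma> \<noteq> 0" and a: "0 \<le> a"
  shows "\<forall>\<^sub>F n in sequentially. Z * s n < (\<integral>\<omega>. max 0 (1 - exp (a * s n + X (s n) \<omega>)) \<partial>M)"
proof -
  let ?f = "\<lambda>x::real. max 0 (min 1 (- x - 1))"
  define c where "c = (\<integral>x. ?f x \<partial>std_normal_distribution)"
  have c: "0 < c"
    unfolding c_def by (rule std_normal_left_tail_pos)
  let ?P = "\<lambda>n. distr M borel (\<lambda>\<omega>. X (s n) \<omega> / (\<bar>\<sigma>\<bar> * sqrt (s n)))"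
  have "(\<lambda>n. \<integral>x. ?f x \<partial>?P n) \<longlonglongrightarrow> c"
    unfolding c_def
  proof (rule weak_conv_imp_integral_bdd_continuous_conv)
    show "weak_conv_m ?P std_normal_distribution"
      by (rule levy_continuity) (auto intro!: real_dist_normal_dist char_scaled_tendsto s \<sigma>)
    show "isCont ?f x" for x
      by (intro continuous_intros)
    show "norm (?f x) \<le> 1" for x by auto
  qed (auto intro!: real_dist_normal_dist)
  then have ev1: "\<forall>\<^sub>F n in sequentially. c / 2 < (\<integral>x. ?f x \<partial>?P n)"
    using c by (intro order_tendstoD) auto
  have sq: "(\<lambda>n. sqrt (s n)) \<longlonglongrightarrow> 0"
    using tendsto_real_sqrt[OF s(2)] by simp
  have "(\<lambda>n. a * sqrt (s n)) \<longlonglongrightarrow> a * 0" "(\<lambda>n. \<bar>\<sigma>\<bar> * sqrt (s n)) \<longlonglongrightarrow> \<bar>\<sigma>\<bar> * 0"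
     "(\<lambda>n. 4 * Z * sqrt (s n)) \<longlonglongrightarrow> 4 * Z * 0"
    by (intro tendsto_intros sq)+
  \<comment> \<open>In terms of q = |\<sigma>| sqrt s: \<open>ev2\<close> gives a s \<le> q, so that
    the drift is absorbed; \<open>ev3\<close> gives q < 1; \<open>ev4\<close> gives Z s \<le> q c /
    4.\<close>
  then have ev2: "\<forall>\<^sub>F n in sequentially. a * sqrt (s n) < \<bar>\<sigma>\<bar>"
    and ev3: "\<forall>\<^sub>F n in sequentially. \<bar>\<sigma>\<bar> * sqrt (s n) < 1"
    and ev4: "\<forall>\<^sub>F n in sequentially. 4 * Z * sqrt (s n) < \<bar>\<sigma>\<bar> * c"
    using order_tendstoD(2)[of "\<lambda>n. a * sqrt (s n)" "a * 0" _ "\<bar>\<sigma>\<bar>"]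
      order_tendstoD(2)[of "\<lambda>n. \<bar>\<sigma>\<bar> * sqrt (s n)" "\<bar>\<sigma>\<bar> * 0" _ 1]
      order_tendstoD(2)[of "\<lambda>n. 4 * Z * sqrt (s n)" "4 * Z * 0" _ "\<bar>\<sigma>\<bar> * c"] \<sigma> c
    by (simp_all del: tendsto_mult_left_iff)
  show ?thesis
    using ev1 ev2 ev3 ev4
  proof eventually_elim
    fix n
    assume e1: "c / 2 < (\<integral>x. ?f x \<partial>?P n)" and e2: "a * sqrt (s n) < \<bar>\<sigma>\<bar>"
      and e3: "\<bar>\<sigma>\<bar> * sqrt (s n) < 1" and e4: "4 * Z * sqrt (s n) < \<bar>\<sigma>\<bar> * c"
    define q where "q = \<bar>\<sigma>\<bar> * sqrt (s n)"
    have q: "0 < q" "q < 1"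
      using e3 s(1)[of n] \<sigma> by (auto simp: q_def)
    have ss: "sqrt (s n) * sqrt (s n) = s n"
      using s(1)[of n] by simp
    have aq: "a * s n \<le> q"
      using mult_right_mono[OF less_imp_le[OF e2], of "sqrt (s n)"] s(1)[of n]
      by (simp add: q_def mult.assoc ss)
    have pw: "q / 2 * ?f (x / q) \<le> max 0 (1 - exp (a * s n + x))" for x
    proof (cases "x < - q")
      case True
      \<comment> \<open>Truncation at -1 brings \<open>y\<close> into the range of the linear bound
        with c = 1; because q < 1, min q (-x - q) is still at most -y.\<close>
      define y where "y = max (-1) (q + x)"
      have y: "-1 \<le> y" "y \<le> 0" "a * s n + x \<le> q + x"
        using True aq by (auto simp: y_def)
      have "q * ?f (x / q) = min q (- x - q)"
        using True q by (auto simp: field_simps min_def max_def)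
      also have "\<dots> \<le> - y"
        using q by (auto simp: y_def)
      finally have "q / 2 * ?f (x / q) \<le> - y / (1 + 1)" by simp
      also have "\<dots> \<le> 1 - exp y"
        by (rule one_minus_exp_ge) (use y in auto)
      also have "\<dots> \<le> 1 - exp (q + x)"
        by (simp add: y_def)
      also have "\<dots> \<le> 1 - exp (a * s n + x)"
        using y by simp
      finally show ?thesis by (rule max.coboundedI2)
    next
      case False
      then have "?f (x / q) = 0"
        using q by (auto simp: field_simps)
      then show ?thesis by simp
    qed
    have "q / 2 * (c / 2) < q / 2 * (\<integral>x. ?f x \<partial>?P n)"
      using e1 q by (intro mult_strict_left_mono) auto
    also have "\<dots> = (\<integral>\<omega>. q / 2 * ?f (X (s n) \<omega> / q) \<partial>M)"
      by (simp add: integral_distr q_def)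
    also have "\<dots> \<le> (\<integral>\<omega>. max 0 (1 - exp (a * s n + X (s n) \<omega>)) \<partial>M)"
    proof (rule integral_mono)
      show "integrable M (\<lambda>\<omega>. q / 2 * ?f (X (s n) \<omega> / q))"
        by (rule integrable_X_bounded[where B = 1]) (use q in \<open>auto simp: abs_mult intro!: order_trans[OF mult_le_one]\<close>)
      show "integrable M (\<lambda>\<omega>. max 0 (1 - exp (a * s n + X (s n) \<omega>)))"
        by (rule integrable_X_bounded[where B = 1]) auto
    qed (rule pw)
    finally have "q / 2 * (c / 2) < (\<integral>\<omega>. max 0 (1 - exp (a * s n + X (s n) \<omega>)) \<partial>M)" .
    moreover have "Z * s n \<le> q / 2 * (c / 2)"
    proof -
      have "4 * Z * sqrt (s n) * sqrt (s n) \<le> \<bar>\<sigma>\<bar> * c * sqrt (s n)"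
        using less_imp_le[OF e4] s(1)[of n] by (intro mult_right_mono) auto
      then have "4 * (Z * s n) \<le> \<bar>\<sigma>\<bar> * c * sqrt (s n)"
        by (simp only: mult.assoc ss)
      then show ?thesis by (simp add: q_def algebra_simps)
    qed
    ultimately show "Z * s n < (\<integral>\<omega>. max 0 (1 - exp (a * s n + X (s n) \<omega>)) \<partial>M)"
      by linarith
  qed
qed

end

section \<open>The jump case: laws reweighted by 1 - cos x\<close>

text \<open>Multiplication by 1 - cos x acts on the Fourier side as a symmetric second difference
  with step 1. Fourier transforms of the reweighted measures thus become combinations of values of
  the characteristic function or of the exponent.\<close>

lemma iexp_times_one_minus_cos:
  "iexp (v * x) * complex_of_real (1 - cos x) = iexp (v * x) - (iexp ((v + 1) * x) + iexp ((v - 1) * x)) / 2"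
proof -
  have "complex_of_real (cos x) = (iexp x + iexp (- x)) / 2"
    by (simp add: cos_of_real[symmetric] cos_exp_eq)
  moreover have "iexp ((v + 1) * x) = iexp (v * x) * iexp x" "iexp ((v - 1) * x) = iexp (v * x) * iexp (- x)"
    by (simp_all add: exp_add[symmetric] algebra_simps)
  ultimately show ?thesis
    unfolding of_real_diff of_real_1
    by (simp only: ring_distribs add_divide_distrib times_divide_eq_right mult_1_right)
qed

lemma one_minus_cos_bounds: "0 \<le> 1 - cos x" "1 - cos x \<le> 2 * min 1 (x\<^sup>2)" for x :: real
proof -
  show "0 \<le> 1 - cos x" by simp
  have "1 - cos x = 2 * (sin (x / 2))\<^sup>2"
    using cos_double_sin[of "x / 2"] by simp
  also have "\<dots> \<le> 2 * (x / 2)\<^sup>2"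
    by (intro mult_left_mono iffD1[OF abs_le_square_iff] abs_sin_x_le_abs_x) auto
  also have "\<dots> \<le> 2 * x\<^sup>2"
    by (simp add: power_divide)
  finally show "1 - cos x \<le> 2 * min 1 (x\<^sup>2)"
    using cos_ge_minus_one[of x] by (simp add: min_def)
qed

text \<open>The continuity theorem is about probability measures, so a finite weighted measure is
  divided by its mass \<open>k\<close>. The second identity returns from the normalized measure to
  the original one.\<close>

lemma
  fixes N :: "real measure"
  assumes [measurable_cong]: "sets N = sets borel" and w: "integrable N w" "\<And>x. 0 \<le> w x"
    and k: "(\<integral>x. w x \<partial>N) = k" "0 < k"
  shows real_distribution_normalized_density: "real_distribution (density N (\<lambda>x. ennreal (w x / k)))"
    and integral_normalized_density:
      "\<And>f :: real \<Rightarrow> 'b::{banach, second_countable_topology}. f \<in> borel_measurable borel \<Longrightarrow>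
        (\<integral>x. f x \<partial>density N (\<lambda>x. ennreal (w x / k))) = (1 / k) *\<^sub>R (\<integral>x. w x *\<^sub>R f x \<partial>N)"
proof -
  have [measurable]: "w \<in> borel_measurable N" using w by auto
  have "emeasure (density N (\<lambda>x. ennreal (w x / k))) (space N) = (\<integral>\<^sup>+ x. ennreal (w x / k) \<partial>N)"
    by (subst emeasure_density) (auto cong: nn_integral_cong)
  also have "\<dots> = ennreal (\<integral>x. w x / k \<partial>N)"
    by (rule nn_integral_eq_integral) (use w k in auto)
  also have "\<dots> = 1"
    using k by simp
  finally show "real_distribution (density N (\<lambda>x. ennreal (w x / k)))"
    unfolding real_distribution_def real_distribution_axioms_def
    using assms(1) by (auto intro!: prob_spaceI)
  fix f :: "real \<Rightarrow> 'b" assume [measurable]: "f \<in> borel_measurable borel"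
  have "(\<integral>x. f x \<partial>density N (\<lambda>x. ennreal (w x / k))) = (\<integral>x. (w x / k) *\<^sub>R f x \<partial>N)"
    by (rule integral_density) (use w k in auto)
  also have "\<dots> = (\<integral>x. (1 / k) *\<^sub>R (w x *\<^sub>R f x) \<partial>N)"
    by simp
  also have "\<dots> = (1 / k) *\<^sub>R (\<integral>x. w x *\<^sub>R f x \<partial>N)"
  proof (cases "integrable N (\<lambda>x. w x *\<^sub>R f x)")
    case True
    then show ?thesis by (intro integral_scaleR_right)
  next
    \<comment> \<open>Both sides are 0 here, the default value of the integral of a non-integrable
      function.\<close>
    case False
    then have "\<not> integrable N (\<lambda>x. (1 / k) *\<^sub>R (w x *\<^sub>R f x))"
      using k(2) integrable_scaleR_right[of k N "\<lambda>x. (1 / k) *\<^sub>R (w x *\<^sub>R f x)"] by auto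
    then show ?thesis
      using not_integrable_integral_eq[OF False] not_integrable_integral_eq[of N "\<lambda>x. (1 / k) *\<^sub>R (w x *\<^sub>R f x)"] by (metis scaleR_zero_right)
  qed
  finally show "(\<integral>x. f x \<partial>density N (\<lambda>x. ennreal (w x / k))) = (1 / k) *\<^sub>R (\<integral>x. w x *\<^sub>R f x \<partial>N)" .
qed

context levy
begin

lemma integrable_nu_one_minus_cos: "integrable \<nu> (\<lambda>x. 1 - cos x)"
  by (rule integrable_nu_bound[where c = 2]) (use one_minus_cos_bounds in auto)

text \<open>The terms linear in the frequency, drift and compensator, cancel in the second
  difference, as does the constant -1. The quadratic term leaves \<sigma>^2/2 and the rest is the
  Fourier transform of (1 - cos x) \<nu>(dx), a finite measure.\<close>

lemma exponent_second_difference: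
  "\<psi> v - (\<psi> (v + 1) + \<psi> (v - 1)) / 2 =
     complex_of_real (\<sigma>\<^sup>2 / 2) + (CLINT x|\<nu>. iexp (v * x) * complex_of_real (1 - cos x))"
proof -
  define I where "I u = (CLINT x|\<nu>. levy_integrand u x)" for u
  have \<psi>: "\<psi> u = - complex_of_real (\<sigma>\<^sup>2 * u\<^sup>2 / 2) + \<i> * complex_of_real (\<gamma> * u) + I u" for u
    by (simp add: levy_exponent_def I_def)
  have "(CLINT x|\<nu>. iexp (v * x) * complex_of_real (1 - cos x)) =
        (CLINT x|\<nu>. levy_integrand v x - (levy_integrand (v + 1) x + levy_integrand (v - 1) x) / 2)"
    by (intro Bochner_Integration.integral_cong refl)
       (unfold iexp_times_one_minus_cos, simp add: field_simps)
  also have "\<dots> = I v - (I (v + 1) + I (v - 1)) / 2"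
    unfolding I_def
    by (simp only: Bochner_Integration.integral_diff Bochner_Integration.integral_add integral_divide_zero
        integrable_levy_integrand integrable_divide Bochner_Integration.integrable_add)
  finally have *: "(CLINT x|\<nu>. iexp (v * x) * complex_of_real (1 - cos x)) = I v - (I (v + 1) + I (v - 1)) / 2" .
  show ?thesis
    unfolding * \<psi> by (simp add: field_simps power2_eq_square)
qed

lemma char_second_difference:
  "(CLINT x|distr M borel (X s). iexp (v * x) * complex_of_real (1 - cos x)) =
    char (distr M borel (X s)) v - (char (distr M borel (X s)) (v + 1) + char (distr M borel (X s)) (v - 1)) / 2"
proof -
  interpret D: real_distribution "distr M borel (X s)" by simp
  have "integrable (distr M borel (X s)) (\<lambda>x. iexp (u * x))" for u
    by (rule D.integrable_iexp) auto
  then show ?thesis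
    unfolding iexp_times_one_minus_cos char_def
    by (simp only: Bochner_Integration.integral_diff Bochner_Integration.integral_add integral_divide_zero
        integrable_divide Bochner_Integration.integrable_add)
qed

text \<open>This is the derivative of z \<mapsto> exp (z \<psi>(v)) at 0, taken along a sequence
  that never meets 0.\<close>

lemma char_difference_quotient:
  fixes s :: "nat \<Rightarrow> real"
  assumes s: "\<And>n. 0 < s n" "s \<longlonglongrightarrow> 0"
  shows "(\<lambda>n. (char (distr M borel (X (s n))) v - 1) / s n) \<longlonglongrightarrow> \<psi> v"
proof -
  have "((\<lambda>z. exp (z * \<psi> v)) has_field_derivative \<psi> v) (at 0)"
    by (auto intro!: derivative_eq_intros)
  then have "((\<lambda>h. (exp (h * \<psi> v) - 1) / h) \<longlongrightarrow> \<psi> v) (at 0)"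
    unfolding has_field_derivative_iff by simp
  then have "(\<lambda>n. (exp (complex_of_real (s n) * \<psi> v) - 1) / complex_of_real (s n)) \<longlonglongrightarrow> \<psi> v"
  proof (rule filterlim_compose)
    show "filterlim (\<lambda>n. complex_of_real (s n)) (at 0) sequentially"
      unfolding filterlim_at using tendsto_of_real[OF s(2), where 'a = complex] s(1)
      by (auto simp: less_imp_neq[symmetric] intro!: always_eventually)
  qed
  then show ?thesis
    using s by (simp add: char_X less_imp_le)
qed

text \<open>Second differences of the difference quotients show that the Fourier transforms of (1 -
  cos x) P(X_s \<in> dx) / s converge to that of (1 - cos x) \<nu>(dx). After normalization the
  continuity theorem gives weak convergence; the masses are then multiplied back.\<close>

lemma one_minus_cos_weighted_limit:
  fixes s :: "nat \<Rightarrow> real" and g :: "real \<Rightarrow> real"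
  assumes s: "\<And>n. 0 < s n" "s \<longlonglongrightarrow> 0" and \<sigma>: "\<sigma> = 0" and pos: "0 < (\<integral>x. 1 - cos x \<partial>\<nu>)"
    and g: "\<And>x. isCont g x" "\<And>x. \<bar>g x\<bar> \<le> B"
  shows "(\<lambda>n. (\<integral>\<omega>. (1 - cos (X (s n) \<omega>)) * g (X (s n) \<omega>) \<partial>M) / s n) \<longlonglongrightarrow> (\<integral>x. (1 - cos x) * g x \<partial>\<nu>)"
proof -
  let ?P = "\<lambda>n. distr M borel (X (s n))"
  define k where "k n = (\<integral>x. 1 - cos x \<partial>?P n)" for n
  define m where "m = (\<integral>x. 1 - cos x \<partial>\<nu>)"
  have g_meas [measurable]: "g \<in> borel_measurable borel"
    using g(1) by (intro borel_measurable_continuous_onI continuous_at_imp_continuous_on) auto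
  have lim: "(\<lambda>n. (CLINT x|?P n. iexp (v * x) * complex_of_real (1 - cos x)) / s n)
      \<longlonglongrightarrow> (CLINT x|\<nu>. iexp (v * x) * complex_of_real (1 - cos x))" for v
  proof -
    have "(\<lambda>n. (char (?P n) v - 1) / s n - ((char (?P n) (v + 1) - 1) / s n + (char (?P n) (v - 1) - 1) / s n) / 2)
      \<longlonglongrightarrow> \<psi> v - (\<psi> (v + 1) + \<psi> (v - 1)) / 2"
      by (intro tendsto_intros char_difference_quotient s) auto
    moreover have "(char (?P n) v - 1) / s n - ((char (?P n) (v + 1) - 1) / s n + (char (?P n) (v - 1) - 1) / s n) / 2
      = (CLINT x|?P n. iexp (v * x) * complex_of_real (1 - cos x)) / s n" for n
      unfolding char_second_difference using s(1)[of n] by (simp add: field_simps)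
    ultimately show ?thesis
      unfolding exponent_second_difference using \<sigma> by simp
  qed
  have int_P: "integrable (?P n) (\<lambda>x. 1 - cos x)" for n
  proof -
    interpret D: real_distribution "?P n" by simp
    show ?thesis
      by (rule D.integrable_const_bound[where B = 2]) (auto intro!: AE_I2 order_trans[OF one_minus_cos_bounds(2)])
  qed
  \<comment> \<open>Convergence of the total masses is the case of frequency 0.\<close>
  have k_lim: "(\<lambda>n. k n / s n) \<longlonglongrightarrow> m"
  proof -
    have "(\<lambda>n. complex_of_real (k n / s n)) \<longlonglongrightarrow> complex_of_real m"
    proof -
      have "(CLINT x|Q. iexp (0 * x) * complex_of_real (1 - cos x)) = complex_of_real (\<integral>x. 1 - cos x \<partial>Q)" for Q
        by (subst integral_complex_of_real[symmetric]) simp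
      then show ?thesis
        using lim[of 0] by (simp only: k_def m_def of_real_divide)
    qed
    then show ?thesis
      by (simp only: tendsto_of_real_iff)
  qed
  then have "\<forall>\<^sub>F n in sequentially. 0 < k n / s n"
    using pos by (intro order_tendstoD) (auto simp: m_def)
  then have "\<forall>\<^sub>F n in sequentially. 0 < k n"
    by eventually_elim (use s(1) less_not_sym in \<open>auto simp: zero_less_divide_iff\<close>)
  \<comment> \<open>The masses are known to be positive only eventually, while every member of the
    sequence must be a probability measure; hence the shift by \<open>N\<close>, undone at the
    end.\<close>
  then obtain N where N: "\<And>n. n \<ge> N \<Longrightarrow> 0 < k n"
    by (auto simp: eventually_sequentially)
  let ?Q = "\<lambda>n. density (?P (n + N)) (\<lambda>x. ennreal ((1 - cos x) / k (n + N)))"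
  let ?Q' = "density \<nu> (\<lambda>x. ennreal ((1 - cos x) / m))"
  have Q: "real_distribution (?Q n)" for n
    by (rule real_distribution_normalized_density) (use int_P N in \<open>auto simp: k_def\<close>)
  have Q': "real_distribution ?Q'"
    by (rule real_distribution_normalized_density) (use integrable_nu_one_minus_cos pos in \<open>auto simp: m_def\<close>)
  have int_Q: "(\<integral>x. f x \<partial>?Q n) = (1 / k (n + N)) *\<^sub>R (\<integral>x. (1 - cos x) *\<^sub>R f x \<partial>?P (n + N))"
    if "f \<in> borel_measurable borel" for f :: "real \<Rightarrow> 'b::{banach, second_countable_topology}" and n
    by (rule integral_normalized_density) (use int_P N that in \<open>auto simp: k_def\<close>)
  have int_Q': "(\<integral>x. f x \<partial>?Q') = (1 / m) *\<^sub>R (\<integral>x. (1 - cos x) *\<^sub>R f x \<partial>\<nu>)"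
    if "f \<in> borel_measurable borel" for f :: "real \<Rightarrow> 'b::{banach, second_countable_topology}"
    by (rule integral_normalized_density) (use integrable_nu_one_minus_cos pos that in \<open>auto simp: m_def\<close>)
  have k_lim': "(\<lambda>n. k (n + N) / s (n + N)) \<longlonglongrightarrow> m"
    using LIMSEQ_ignore_initial_segment[OF k_lim] .
  have "weak_conv_m ?Q ?Q'"
  proof (rule levy_continuity[OF Q Q'])
    fix v
    have "(\<lambda>n. ((CLINT x|?P (n + N). iexp (v * x) * complex_of_real (1 - cos x)) / s (n + N))
             / complex_of_real (k (n + N) / s (n + N)))
      \<longlonglongrightarrow> (CLINT x|\<nu>. iexp (v * x) * complex_of_real (1 - cos x)) / complex_of_real m"
      using pos by (intro tendsto_divide LIMSEQ_ignore_initial_segment[OF lim] tendsto_of_real k_lim')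
        (simp add: m_def)
    moreover have "((CLINT x|?P (n + N). iexp (v * x) * complex_of_real (1 - cos x)) / s (n + N))
             / complex_of_real (k (n + N) / s (n + N)) = char (?Q n) v" for n
    proof -
      have "s (n + N) \<noteq> 0" using s(1) less_imp_neq by metis
      then show ?thesis
        unfolding char_def by (subst int_Q) (simp_all add: scaleR_conv_of_real field_simps)
    qed
    moreover have "(CLINT x|\<nu>. iexp (v * x) * complex_of_real (1 - cos x)) / complex_of_real m = char ?Q' v"
      unfolding char_def by (subst int_Q') (simp_all add: scaleR_conv_of_real field_simps)
    ultimately show "(\<lambda>n. char (?Q n) v) \<longlonglongrightarrow> char ?Q' v"
      by simp
  qed
  then have "(\<lambda>n. \<integral>x. g x \<partial>?Q n) \<longlonglongrightarrow> (\<integral>x. g x \<partial>?Q')"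
    by (intro weak_conv_imp_integral_bdd_continuous_conv[OF Q Q', where B = B] g(1)) (use g(2) in auto)
  then have "(\<lambda>n. (\<integral>x. g x \<partial>?Q n) * (k (n + N) / s (n + N))) \<longlonglongrightarrow> (\<integral>x. g x \<partial>?Q') * m"
    by (intro tendsto_mult k_lim')
  moreover have "(\<integral>x. g x \<partial>?Q n) * (k (n + N) / s (n + N)) =
      (\<integral>\<omega>. (1 - cos (X (s (n + N)) \<omega>)) * g (X (s (n + N)) \<omega>) \<partial>M) / s (n + N)" for n
    using N[of "n + N"] by (subst int_Q) (simp_all add: integral_distr)
  moreover have "(\<integral>x. g x \<partial>?Q') * m = (\<integral>x. (1 - cos x) * g x \<partial>\<nu>)"
    using pos by (subst int_Q') (simp_all add: m_def)
  ultimately have "(\<lambda>n. (\<integral>\<omega>. (1 - cos (X (s (n + N)) \<omega>)) * g (X (s (n + N)) \<omega>) \<partial>M) / s (n + N))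
      \<longlonglongrightarrow> (\<integral>x. (1 - cos x) * g x \<partial>\<nu>)"
    by (simp only:)
  then show ?thesis
    by (rule LIMSEQ_offset)
qed

text \<open>E f(X_s) / s tends to the \<nu>-integral of f for suitable f supported away from 0.
  Infinite variation of the negative jumps makes that integral as large as desired, while f / 3
  stays below the payoff.\<close>

lemma small_time_put_jumps:
  fixes s :: "nat \<Rightarrow> real"
  assumes s: "\<And>n. 0 < s n" "s \<longlonglongrightarrow> 0" and \<sigma>: "\<sigma> = 0" and a: "0 \<le> a"
    and inf: "(\<integral>\<^sup>+ x \<in> {-1..0}. ennreal (- x) \<partial>\<nu>) = \<infinity>"
  shows "\<forall>\<^sub>F n in sequentially. Z * s n < (\<integral>\<omega>. max 0 (1 - exp (a * s n + X (s n) \<omega>)) \<partial>M)"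
proof -
  \<comment> \<open>A tent vanishing outside (-2, -\<epsilon>): it increases as \<epsilon> decreases
    to 0, and its limit is -x on [-1,0]. The left end -2 is beyond -\<pi>, so 1 - cos x does not
    vanish on the support.\<close>
  define f where "f \<epsilon> x = max 0 (min (- x - \<epsilon>) (x + 2))" for \<epsilon> x :: real
  have f_meas [measurable]: "f \<epsilon> \<in> borel_measurable borel" for \<epsilon>
    unfolding f_def by measurable
  \<comment> \<open>Monotone convergence along \<epsilon> = 1/(n+1). The factor 3 pays for the slope
    1/(1+2) of the linear bound on [-2,0].\<close>
  obtain \<epsilon> where \<epsilon>: "0 < \<epsilon>" "\<epsilon> \<le> 1" and big: "ennreal (3 * \<bar>Z\<bar>) < (\<integral>\<^sup>+ x. ennreal (f \<epsilon> x) \<partial>\<nu>)"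
  proof -
    let ?F = "\<lambda>n x. ennreal (f (1 / real (Suc n)) x)"
    have "(\<integral>\<^sup>+ x. (SUP n. ?F n x) \<partial>\<nu>) = (SUP n. \<integral>\<^sup>+ x. ?F n x \<partial>\<nu>)"
    proof (rule nn_integral_monotone_convergence_SUP)
      show "incseq ?F"
        unfolding f_def
        by (intro incseq_SucI le_funI ennreal_leI max.mono min.mono diff_left_mono frac_le) auto
    qed measurable
    moreover have "(\<integral>\<^sup>+ x. (SUP n. ?F n x) \<partial>\<nu>) = \<infinity>"
    proof -
      have le: "ennreal (- x) * indicator {-1..0} x \<le> (SUP n. ?F n x)" for x
      proof (cases "x \<in> {-1..0}")
        case True
        have "(\<lambda>n. ?F n x) \<longlonglongrightarrow> ennreal (max 0 (min (- x - 0) (x + 2)))"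
          unfolding f_def
          by (intro tendsto_ennrealI tendsto_intros tendsto_max tendsto_min LIMSEQ_inverse_real_of_nat[unfolded inverse_eq_divide])
        then have "(\<lambda>n. ?F n x) \<longlonglongrightarrow> ennreal (- x)"
          using True by (simp add: min_def max_def)
        moreover have "\<forall>n. ?F n x \<le> (SUP n. ?F n x)"
          by (auto intro!: SUP_upper)
        ultimately show ?thesis
          using True by (auto intro!: LIMSEQ_le_const2)
      qed auto
      have "\<infinity> \<le> (\<integral>\<^sup>+ x. (SUP n. ?F n x) \<partial>\<nu>)"
        unfolding inf[symmetric] by (intro nn_integral_mono le)
      then show ?thesis by (simp add: top_unique)
    qed
    ultimately have "ennreal (3 * \<bar>Z\<bar>) < (SUP n. \<integral>\<^sup>+ x. ?F n x \<partial>\<nu>)"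
      by (metis ennreal_less_top infinity_ennreal_def)
    then obtain n where "ennreal (3 * \<bar>Z\<bar>) < (\<integral>\<^sup>+ x. ?F n x \<partial>\<nu>)"
      by (auto simp: less_SUP_iff)
    then show thesis
      by (intro that[of "1 / real (Suc n)"]) auto
  qed
  \<comment> \<open>The quotient of f by the weight, with the denominator kept at least 1 - cos
    \<epsilon> so that \<open>g\<close> is bounded and continuous everywhere. On the support of f
    the truncation is inactive, since \<open>cos\<close> decreases on [0,\<pi>].\<close>
  define g where "g x = f \<epsilon> x / max (1 - cos x) (1 - cos \<epsilon>)" for x
  have ce: "0 < 1 - cos \<epsilon>"
    using \<epsilon> cos_monotone_0_pi[of 0 \<epsilon>] pi_gt3 by simp
  have f_bd: "0 \<le> f \<epsilon> x" "f \<epsilon> x \<le> 2" for x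
    using \<epsilon> by (auto simp: f_def)
  have gf: "(1 - cos x) * g x = f \<epsilon> x" for x
  proof (cases "-2 \<le> x \<and> x \<le> - \<epsilon>")
    case True
    then have "cos (- x) \<le> cos \<epsilon>"
      using \<epsilon> pi_gt3 by (intro cos_monotone_0_pi_le) auto
    then have "max (1 - cos x) (1 - cos \<epsilon>) = 1 - cos x" "1 - cos x \<noteq> 0"
      using ce by auto
    then show ?thesis by (simp add: g_def)
  next
    case False
    then have "f \<epsilon> x = 0" by (auto simp: f_def)
    then show ?thesis by (simp add: g_def)
  qed
  have g_bd: "\<bar>g x\<bar> \<le> 2 / (1 - cos \<epsilon>)" for x
    using f_bd[of x] ce unfolding g_def by (simp add: abs_divide) (intro frac_le; simp)
  have g_cont: "isCont g x" for x
    unfolding g_def f_def using ce by (intro continuous_intros) (auto simp: max_def)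
  have f_int: "integrable \<nu> (f \<epsilon>)"
  proof (rule integrable_nu_bound[where c = "4 / (1 - cos \<epsilon>)"])
    fix x
    have "\<bar>f \<epsilon> x\<bar> = (1 - cos x) * \<bar>g x\<bar>"
      using one_minus_cos_bounds(1)[of x] by (simp add: gf[symmetric] abs_mult)
    also have "\<dots> \<le> (2 * min 1 (x\<^sup>2)) * (2 / (1 - cos \<epsilon>))"
      by (intro mult_mono one_minus_cos_bounds g_bd) auto
    finally show "norm (f \<epsilon> x) \<le> 4 / (1 - cos \<epsilon>) * min 1 (x\<^sup>2)" by simp
  qed measurable
  have big': "3 * \<bar>Z\<bar> < (\<integral>x. f \<epsilon> x \<partial>\<nu>)"
    using big f_bd by (subst (asm) nn_integral_eq_integral[OF f_int]) (auto simp: ennreal_less_iff)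
  have pos: "0 < (\<integral>x. 1 - cos x \<partial>\<nu>)"
  proof -
    have "(\<integral>x. f \<epsilon> x \<partial>\<nu>) \<le> (\<integral>x. (1 - cos x) * (2 / (1 - cos \<epsilon>)) \<partial>\<nu>)"
    proof (intro integral_mono f_int integrable_mult_left integrable_nu_one_minus_cos)
      fix x
      show "f \<epsilon> x \<le> (1 - cos x) * (2 / (1 - cos \<epsilon>))"
        unfolding gf[symmetric] using g_bd[of x] by (intro mult_left_mono) (auto simp: abs_le_iff)
    qed
    also have "\<dots> = (\<integral>x. 1 - cos x \<partial>\<nu>) * (2 / (1 - cos \<epsilon>))"
      by (rule integral_mult_left_zero)
    finally have "0 < (\<integral>x. 1 - cos x \<partial>\<nu>) * (2 / (1 - cos \<epsilon>))"
      using big' by linarith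
    then show ?thesis
      using ce by (simp add: zero_less_mult_iff zero_less_divide_iff)
  qed
  have "(\<lambda>n. (\<integral>\<omega>. (1 - cos (X (s n) \<omega>)) * g (X (s n) \<omega>) \<partial>M) / s n) \<longlonglongrightarrow> (\<integral>x. (1 - cos x) * g x \<partial>\<nu>)"
    by (rule one_minus_cos_weighted_limit[OF s \<sigma> pos g_cont g_bd])
  then have "(\<lambda>n. (\<integral>\<omega>. f \<epsilon> (X (s n) \<omega>) \<partial>M) / s n) \<longlonglongrightarrow> (\<integral>x. f \<epsilon> x \<partial>\<nu>)"
    by (simp only: gf)
  then have ev1: "\<forall>\<^sub>F n in sequentially. 3 * \<bar>Z\<bar> < (\<integral>\<omega>. f \<epsilon> (X (s n) \<omega>) \<partial>M) / s n"
    using big' by (rule order_tendstoD)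
  have "(\<lambda>n. a * s n) \<longlonglongrightarrow> a * 0"
    by (intro tendsto_intros s)
  then have ev2: "\<forall>\<^sub>F n in sequentially. a * s n < \<epsilon>"
    using \<epsilon> by (intro order_tendstoD) auto
  show ?thesis
    using ev1 ev2
  proof eventually_elim
    fix n
    assume e1: "3 * \<bar>Z\<bar> < (\<integral>\<omega>. f \<epsilon> (X (s n) \<omega>) \<partial>M) / s n" and e2: "a * s n < \<epsilon>"
    \<comment> \<open>The drift a s is less than \<epsilon>, so on the support the shifted argument
      x + \<epsilon> lies in [-2,0], where the linear bound with c = 2 applies.\<close>
    have pw: "f \<epsilon> x / 3 \<le> max 0 (1 - exp (a * s n + x))" for x
    proof (cases "-2 \<le> x \<and> x \<le> - \<epsilon>")
      case True
      then have "f \<epsilon> x / 3 \<le> - (x + \<epsilon>) / (1 + 2)"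
        by (auto simp: f_def)
      also have "\<dots> \<le> 1 - exp (x + \<epsilon>)"
        by (rule one_minus_exp_ge) (use True \<epsilon> in auto)
      also have "\<dots> \<le> 1 - exp (a * s n + x)"
        using e2 by simp
      finally show ?thesis by (rule max.coboundedI2)
    next
      case False
      then have "f \<epsilon> x = 0" by (auto simp: f_def)
      then show ?thesis by simp
    qed
    have "Z * s n \<le> \<bar>Z\<bar> * s n"
      using s(1)[of n] by (intro mult_right_mono) auto
    also have "\<dots> < (\<integral>\<omega>. f \<epsilon> (X (s n) \<omega>) \<partial>M) / 3"
      using e1 s(1)[of n] by (simp add: field_simps)
    also have "\<dots> = (\<integral>\<omega>. f \<epsilon> (X (s n) \<omega>) / 3 \<partial>M)"
      by simp
    also have "\<dots> \<le> (\<integral>\<omega>. max 0 (1 - exp (a * s n + X (s n) \<omega>)) \<partial>M)"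
    proof (rule integral_mono)
      show "integrable M (\<lambda>\<omega>. f \<epsilon> (X (s n) \<omega>) / 3)"
        by (rule integrable_X_bounded[where B = 1]) (use f_bd in \<open>auto simp: abs_le_iff intro: order_trans[of _ 0] order_trans[of _ 2]\<close>)
      show "integrable M (\<lambda>\<omega>. max 0 (1 - exp (a * s n + X (s n) \<omega>)))"
        by (rule integrable_X_bounded[where B = 1]) auto
    qed (rule pw)
    finally show "Z * s n < (\<integral>\<omega>. max 0 (1 - exp (a * s n + X (s n) \<omega>)) \<partial>M)" .
  qed
qed

text \<open>When \<sigma> = 0, the inequality x \<le> exp x - 1 turns the finite integral
  \<open>up\<close> into finite variation of the small positive jumps, so the infinite variation
  must come from the negative ones.\<close>

lemma small_time_put:
  assumes "0 \<le> a"
    and inf_var: "\<sigma> \<noteq> 0 \<or> (\<integral>\<^sup>+ x \<in> {-1..1}. ennreal \<bar>x\<bar> \<partial>\<nu>) = \<infinity>"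
    and up: "(\<integral>\<^sup>+ y. ennreal (max 0 (exp y - 1)) \<partial>\<nu>) < \<infinity>"
  shows "\<forall>\<^sub>F s in at_right 0. Z * s < (\<integral>\<omega>. max 0 (1 - exp (a * s + X s \<omega>)) \<partial>M)"
proof (rule sequentially_imp_eventually_at_right[of 0 1])
  fix s :: "nat \<Rightarrow> real" assume s: "\<And>n. 0 < s n" "s \<longlonglongrightarrow> 0"
  show "\<forall>\<^sub>F n in sequentially. Z * s n < (\<integral>\<omega>. max 0 (1 - exp (a * s n + X (s n) \<omega>)) \<partial>M)"
  proof (cases "\<sigma> = 0")
    case True
    have "(\<integral>\<^sup>+ x \<in> {-1..1}. ennreal \<bar>x\<bar> \<partial>\<nu>) \<le>
        (\<integral>\<^sup>+ x. ennreal (- x) * indicator {-1..0} x + ennreal (max 0 (exp x - 1)) \<partial>\<nu>)"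
    proof (rule nn_integral_mono)
      fix x :: real
      show "ennreal \<bar>x\<bar> * indicator {-1..1} x \<le> ennreal (- x) * indicator {-1..0} x + ennreal (max 0 (exp x - 1))"
      proof -
        have "x \<le> exp x - 1"
          using exp_ge_add_one_self[of x] by linarith
        then show ?thesis
          by (cases "x < 0") (auto simp: indicator_def intro!: ennreal_leI)
      qed
    qed
    also have "\<dots> = (\<integral>\<^sup>+ x \<in> {-1..0}. ennreal (- x) \<partial>\<nu>) + (\<integral>\<^sup>+ x. ennreal (max 0 (exp x - 1)) \<partial>\<nu>)"
      by (rule nn_integral_add) auto
    finally have "(\<integral>\<^sup>+ x \<in> {-1..0}. ennreal (- x) \<partial>\<nu>) = \<infinity>"
      using inf_var True up by (auto simp: top_unique)
    then show ?thesis
      by (intro small_time_put_jumps s True assms(1))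
  next
    case False
    then show ?thesis
      by (intro small_time_put_gaussian s assms(1))
  qed
qed simp

end

section \<open>Stopped Gaussian bumps\<close>

definition gauss_bump :: "real \<Rightarrow> real" where
  "gauss_bump y = exp (y - y\<^sup>2 / 2)"

text \<open>Completing the square shows a multiple of the standard normal characteristic function at
  y - 1, the form used by the Fourier argument.\<close>

lemma gauss_bump_eq: "gauss_bump y = exp (1/2) * exp (- ((y - 1)\<^sup>2) / 2)"
  unfolding gauss_bump_def exp_add[symmetric] by (simp add: power2_eq_square field_simps)

lemma gauss_bump_bounds: "0 \<le> gauss_bump y" "gauss_bump y \<le> exp y" "gauss_bump y \<le> 2"
proof -
  have "gauss_bump y \<le> exp (1/2) * 1"
    unfolding gauss_bump_eq by (intro mult_left_mono) auto
  also have "exp (1/2::real) \<le> 2"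
    using exp_half_le2 by simp
  finally show "gauss_bump y \<le> 2" by simp
qed (auto simp: gauss_bump_def)

lemma gauss_bump_0: "gauss_bump 0 = 1"
  by (simp add: gauss_bump_def)

lemma isCont_gauss_bump: "isCont gauss_bump y"
  unfolding gauss_bump_def by (intro continuous_intros) auto

lemma borel_measurable_gauss_bump [measurable]: "gauss_bump \<in> borel_measurable borel"
  unfolding gauss_bump_def by measurable

context levy
begin

text \<open>The bump at y is exp(1/2) E exp(i U (y - 1)) with U standard normal. By Fubini, adding
  X_h to y inserts the factor char(U), so the change is at most exp(1/2) C h E(1 + U^2) \<le> 4 C h,
  uniformly in y.\<close>

lemma gauss_bump_one_step:
  obtains C where "C \<ge> 0"
    "\<And>h y. 0 \<le> h \<Longrightarrow> (\<integral>\<omega>. gauss_bump (y + X h \<omega>) \<partial>M) \<ge> gauss_bump y - C * h"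
proof -
  interpret N: real_distribution std_normal_distribution
    by (rule real_dist_normal_dist)
  obtain C where C: "C \<ge> 0" "\<And>h u. 0 \<le> h \<Longrightarrow> norm (char (distr M borel (X h)) u - 1) \<le> C * h * (1 + u\<^sup>2)"
    using char_minus_1_bound by auto
  have bump: "complex_of_real (gauss_bump y) = exp (1/2) * (CLINT u|std_normal_distribution. iexp (u * (y - 1)))" for y
  proof -
    have "(CLINT u|std_normal_distribution. iexp (u * (y - 1))) = char std_normal_distribution (y - 1)"
      unfolding char_def by (simp add: mult.commute)
    then show ?thesis
      by (simp add: char_std_normal_distribution gauss_bump_eq exp_of_real[symmetric])
  qed
  have u2: "integrable std_normal_distribution (\<lambda>u. u\<^sup>2)" "(\<integral>u. u\<^sup>2 \<partial>std_normal_distribution) = 1"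
    using integrable_std_normal_distribution_moment[of 2] std_normal_distribution_even_moments[of 1]
    by simp_all
  have "\<bar>(\<integral>\<omega>. gauss_bump (y + X h \<omega>) \<partial>M) - gauss_bump y\<bar> \<le> (4 * C) * h" if h: "0 \<le> h" for h y
  proof -
    let ?P = "distr M borel (X h)"
    interpret P: real_distribution ?P by simp
    interpret PN: pair_prob_space ?P std_normal_distribution ..
    have int: "integrable (?P \<Otimes>\<^sub>M std_normal_distribution) (\<lambda>(x, u). iexp (u * (y + x - 1)))"
      by (rule PN.integrable_const_bound[where B = 1]) (auto simp del: of_real_mult of_real_add of_real_diff)
    have "complex_of_real (\<integral>\<omega>. gauss_bump (y + X h \<omega>) \<partial>M) = (CLINT x|?P. complex_of_real (gauss_bump (y + x)))"
      by (simp add: integral_distr)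
    also have "\<dots> = (CLINT x|?P. exp (1/2) * (CLINT u|std_normal_distribution. iexp (u * (y + x - 1))))"
      unfolding bump ..
    also have "\<dots> = exp (1/2) * (CLINT x|?P. CLINT u|std_normal_distribution. iexp (u * (y + x - 1)))"
      by (rule integral_mult_right_zero)
    also have "(CLINT x|?P. CLINT u|std_normal_distribution. iexp (u * (y + x - 1))) =
       (CLINT u|std_normal_distribution. CLINT x|?P. iexp (u * (y + x - 1)))"
      using PN.Fubini_integral[OF int] by simp
    also have "\<dots> = (CLINT u|std_normal_distribution. iexp (u * (y - 1)) * char ?P u)"
    proof (intro Bochner_Integration.integral_cong refl)
      fix u
      have "iexp (u * (y + x - 1)) = iexp (u * (y - 1)) * iexp (u * x)" for x
        by (simp add: exp_add[symmetric] algebra_simps)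
      then show "(CLINT x|?P. iexp (u * (y + x - 1))) = iexp (u * (y - 1)) * char ?P u"
        unfolding char_def by (simp only: integral_mult_right_zero)
    qed
    finally have 1: "complex_of_real (\<integral>\<omega>. gauss_bump (y + X h \<omega>) \<partial>M) =
        exp (1/2) * (CLINT u|std_normal_distribution. iexp (u * (y - 1)) * char ?P u)" .
    have [measurable]: "char ?P \<in> borel_measurable borel"
      by (intro borel_measurable_continuous_onI continuous_at_imp_continuous_on ballI P.isCont_char)
    have i1: "integrable std_normal_distribution (\<lambda>u. iexp (u * (y - 1)) * char ?P u)"
      by (rule N.integrable_const_bound[where B = 1])
         (auto simp: norm_mult P.cmod_char_le_1 simp del: of_real_mult of_real_diff)
    have i2: "integrable std_normal_distribution (\<lambda>u. iexp (u * (y - 1)))"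
      by (rule N.integrable_const_bound[where B = 1]) (auto simp del: of_real_mult of_real_diff)
    have "complex_of_real ((\<integral>\<omega>. gauss_bump (y + X h \<omega>) \<partial>M) - gauss_bump y) =
      exp (1/2) * ((CLINT u|std_normal_distribution. iexp (u * (y - 1)) * char ?P u) - (CLINT u|std_normal_distribution. iexp (u * (y - 1))))"
      unfolding of_real_diff 1 bump by (simp only: right_diff_distrib)
    also have "\<dots> = exp (1/2) * (CLINT u|std_normal_distribution. iexp (u * (y - 1)) * char ?P u - iexp (u * (y - 1)))"
      by (simp only: Bochner_Integration.integral_diff[OF i1 i2])
    finally have "\<bar>(\<integral>\<omega>. gauss_bump (y + X h \<omega>) \<partial>M) - gauss_bump y\<bar> =
        norm (exp (1/2) * (CLINT u|std_normal_distribution. iexp (u * (y - 1)) * char ?P u - iexp (u * (y - 1))))"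
      by (metis norm_of_real real_norm_def)
    also have "\<dots> = exp (1/2) * norm (CLINT u|std_normal_distribution. iexp (u * (y - 1)) * char ?P u - iexp (u * (y - 1)))"
      by (simp add: norm_mult)
    also have "\<dots> \<le> 2 * (\<integral>u. C * h * (1 + u\<^sup>2) \<partial>std_normal_distribution)"
    proof (intro mult_mono)
      show "exp (1 / 2 :: real) \<le> 2" using exp_half_le2 by simp
      have "norm (CLINT u|std_normal_distribution. iexp (u * (y - 1)) * char ?P u - iexp (u * (y - 1)))
         \<le> (\<integral>u. norm (iexp (u * (y - 1)) * char ?P u - iexp (u * (y - 1))) \<partial>std_normal_distribution)"
        by (rule integral_norm_bound)
      also have "\<dots> \<le> (\<integral>u. C * h * (1 + u\<^sup>2) \<partial>std_normal_distribution)"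
      proof (rule integral_mono)
        show "integrable std_normal_distribution (\<lambda>u. norm (iexp (u * (y - 1)) * char ?P u - iexp (u * (y - 1))))"
          using i1 i2 by (intro integrable_norm Bochner_Integration.integrable_diff)
        show "integrable std_normal_distribution (\<lambda>u. C * h * (1 + u\<^sup>2))"
          using u2 by (intro integrable_mult_right Bochner_Integration.integrable_add) auto
        fix u
        have "iexp (u * (y - 1)) * char ?P u - iexp (u * (y - 1)) = iexp (u * (y - 1)) * (char ?P u - 1)"
          by (simp only: right_diff_distrib mult_1_right)
        then have "norm (iexp (u * (y - 1)) * char ?P u - iexp (u * (y - 1))) = norm (char ?P u - 1)"
          by (simp only: norm_mult norm_exp_i_times mult_1)
        then show "norm (iexp (u * (y - 1)) * char ?P u - iexp (u * (y - 1))) \<le> C * h * (1 + u\<^sup>2)"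
          using C(2)[OF h] by simp
      qed
      finally show "norm (CLINT u|std_normal_distribution. iexp (u * (y - 1)) * char ?P u - iexp (u * (y - 1)))
         \<le> (\<integral>u. C * h * (1 + u\<^sup>2) \<partial>std_normal_distribution)" .
    qed auto
    also have "(\<integral>u. C * h * (1 + u\<^sup>2) \<partial>std_normal_distribution) = C * h * (1 + 1)"
      using u2 N.prob_space by (simp add: Bochner_Integration.integral_add)
    finally show ?thesis
      by simp
  qed
  then show thesis
    using C(1) by (intro that[of "4 * C"]) (auto simp: abs_le_iff algebra_simps)
qed

section \<open>Independence of an increment from the past\<close>

text \<open>A pi-system whose generated sigma-algebra contains the natural filtration at
  \<open>t\<close>; independence need then be checked only for finitely many times.\<close>

definition cylinders :: "real \<Rightarrow> 'a set set" where
  "cylinders t = {{\<omega>\<in>space M. \<forall>s\<in>I. X s \<omega> \<in> B s} | I B. finite I \<and> I \<subseteq> {0..t} \<and> (\<forall>s. B s \<in> sets borel)}"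

definition increment_sets :: "real \<Rightarrow> real \<Rightarrow> 'a set set" where
  "increment_sets t h = {(\<lambda>\<omega>. X (t + h) \<omega> - X t \<omega>) -` C \<inter> space M | C. C \<in> sets borel}"

lemma Int_stable_cylinders: "Int_stable (cylinders t)"
proof (rule Int_stableI)
  fix a b assume "a \<in> cylinders t" "b \<in> cylinders t"
  then obtain I B I' B' where
    a: "a = {\<omega>\<in>space M. \<forall>s\<in>I. X s \<omega> \<in> B s}" "finite I" "I \<subseteq> {0..t}" "\<And>s. B s \<in> sets borel" and
    b: "b = {\<omega>\<in>space M. \<forall>s\<in>I'. X s \<omega> \<in> B' s}" "finite I'" "I' \<subseteq> {0..t}" "\<And>s. B' s \<in> sets borel"
    unfolding cylinders_def by blast
  \<comment> \<open>A time constrained by only one of the two cylinders gets \<open>UNIV\<close>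
    from the other.\<close>
  let ?B = "\<lambda>s. (if s \<in> I then B s else UNIV) \<inter> (if s \<in> I' then B' s else UNIV)"
  have "a \<inter> b = {\<omega>\<in>space M. \<forall>s\<in>I \<union> I'. X s \<omega> \<in> ?B s}"
    unfolding a(1) b(1) by auto
  moreover have "?B s \<in> sets borel" for s
    using a(4) b(4) by auto
  ultimately show "a \<inter> b \<in> cylinders t"
    unfolding cylinders_def using a(2,3) b(2,3)
    by (intro CollectI exI[of _ "I \<union> I'"] exI[of _ ?B]) auto
qed

lemma Int_stable_increment_sets: "Int_stable (increment_sets t h)"
proof (rule Int_stableI)
  fix a b assume "a \<in> increment_sets t h" "b \<in> increment_sets t h"
  then obtain C C' where "a = (\<lambda>\<omega>. X (t + h) \<omega> - X t \<omega>) -` C \<inter> space M" "C \<in> sets borel"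
      "b = (\<lambda>\<omega>. X (t + h) \<omega> - X t \<omega>) -` C' \<inter> space M" "C' \<in> sets borel"
    unfolding increment_sets_def by auto
  then show "a \<inter> b \<in> increment_sets t h"
    unfolding increment_sets_def by (intro CollectI exI[of _ "C \<inter> C'"]) auto
qed

text \<open>Independence is given only for increments over a strictly increasing grid. The times of
  the cylinder are therefore sorted into a grid and the values of X rewritten as partial sums of
  increments, using X 0 = 0.\<close>

lemma indep_cylinders_increment:
  assumes t: "0 \<le> t" and h: "0 < h"
  shows "indep_set (cylinders t) (increment_sets t h)"
proof (rule indep_setI)
  show "cylinders t \<subseteq> events"
  proof
    fix a assume "a \<in> cylinders t"
    then obtain I B where
      a: "a = {\<omega>\<in>space M. \<forall>s\<in>I. X s \<omega> \<in> B s}" "finite I" "\<And>s. B s \<in> sets borel"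
      unfolding cylinders_def by blast
    have [measurable]: "B s \<in> sets borel" for s by (rule a)
    show "a \<in> events"
      unfolding a(1) using a(2) by measurable
  qed
  show "increment_sets t h \<subseteq> events"
    unfolding increment_sets_def by auto
  fix a b assume "a \<in> cylinders t" "b \<in> increment_sets t h"
  then obtain I B C where
    a: "a = {\<omega>\<in>space M. \<forall>s\<in>I. X s \<omega> \<in> B s}" "finite I" "I \<subseteq> {0..t}" "\<And>s. B s \<in> sets borel" and
    b: "b = (\<lambda>\<omega>. X (t + h) \<omega> - X t \<omega>) -` C \<inter> space M" "C \<in> sets borel"
    unfolding cylinders_def increment_sets_def by blast
  have [measurable]: "B s \<in> sets borel" "C \<in> sets borel" for s by (rule a b)+
  \<comment> \<open>Adding 0 lets the partial sums start at X 0 = 0; adding \<open>t\<close> makes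
    the last increment start at \<open>t\<close>.\<close>
  define J where "J = insert 0 (insert t I)"
  have J: "finite J" "J \<noteq> {}" "J \<subseteq> {0..t}" "0 \<in> J" "t \<in> J"
    using a(2,3) t by (auto simp: J_def)
  define l where "l = sorted_list_of_set J"
  have l: "sorted_wrt (<) l" "set l = J"
    using J by (auto simp: l_def)
  have "l \<noteq> []" using l J by auto
  then obtain n where n: "length l = Suc n"
    by (cases l) auto
  have mono: "l ! i < l ! j" if "i < j" "j \<le> n" for i j
    using l(1) n that by (auto simp: sorted_wrt_iff_nth_less)
  have inJ: "l ! i \<in> {0..t}" if "i \<le> n" for i
    using l(2) n that J(3) nth_mem[of i l] by auto
  have l0: "l ! 0 = 0"
  proof -
    obtain i where "i \<le> n" "l ! i = 0"
      using J(4) l(2) n by (metis in_set_conv_nth less_Suc_eq_le)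
    then show ?thesis
      using mono[of 0 i] inJ[of 0] by (cases "i = 0") auto
  qed
  have ln: "l ! n = t"
  proof -
    obtain i where "i \<le> n" "l ! i = t"
      using J(5) l(2) n by (metis in_set_conv_nth less_Suc_eq_le)
    then show ?thesis
      using mono[of i n] inJ[of n] by (cases "i = n") auto
  qed
  \<comment> \<open>The sorted list has indices 0 to n, with \<open>tt n\<close> = t and the next
    point \<open>tt (Suc n)\<close> = t + h. Increments 0 to n - 1 describe the past, and increment
    n is the one over [t, t + h].\<close>
  define tt where "tt i = (if i \<le> n then l ! i else t + h)" for i
  define D where "D i \<omega> = X (tt (Suc i)) \<omega> - X (tt i) \<omega>" for i \<omega>
  have "indep_vars (\<lambda>_. borel) D {..<Suc n}"
    unfolding D_def
    by (rule increments_indep) (use mono ln l0 h in \<open>auto simp: tt_def le_less_Suc_eq\<close>)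
  then have ind: "indep_var (PiM {..<n} (\<lambda>_. borel)) (\<lambda>\<omega>. restrict (\<lambda>i. D i \<omega>) {..<n})
        (PiM {n} (\<lambda>_. borel)) (\<lambda>\<omega>. restrict (\<lambda>i. D i \<omega>) {n})"
    by (rule indep_var_restrict) auto
  have X_sum: "X (l ! j) \<omega> = (\<Sum>i<j. D i \<omega>)" if "j \<le> n" "\<omega> \<in> space M" for j \<omega>
  proof -
    have "(\<Sum>i<j. D i \<omega>) = X (tt j) \<omega> - X (tt 0) \<omega>"
      unfolding D_def by (rule sum_lessThan_telescope)
    then show ?thesis
      using that by (simp add: tt_def l0 X_0)
  qed
  \<comment> \<open>The cylinder expressed through the vector of the first \<open>n\<close>
    increments, as \<open>G\<close> expresses the other event through the last one.\<close>
  define F where "F = {f\<in>space (PiM {..<n} (\<lambda>_. borel)). \<forall>j\<in>{..n}. l ! j \<in> I \<longrightarrow> (\<Sum>i<j. f i) \<in> B (l ! j)}"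
  define G where "G = {f\<in>space (PiM {n} (\<lambda>_. borel)). f n \<in> C}"
  have F: "F \<in> sets (PiM {..<n} (\<lambda>_. borel))"
    unfolding F_def
  proof (intro sets.sets_Collect_finite_All sets.sets_Collect_imp)
    fix j assume j: "j \<in> {..n}"
    have "(\<lambda>f. \<Sum>i<j. f i) \<in> borel_measurable (PiM {..<n} (\<lambda>_. borel :: real measure))"
      using j by (intro borel_measurable_sum measurable_component_singleton) auto
    then show "{x \<in> space (Pi\<^sub>M {..<n} (\<lambda>_. borel)). (\<Sum>i<j. x i) \<in> B (l ! j)} \<in> sets (PiM {..<n} (\<lambda>_. borel))"
      using a(4)[of "l ! j"] by measurable
  qed auto
  have G: "G \<in> sets (PiM {n} (\<lambda>_. borel))"
    unfolding G_def by measurable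
  have eqF: "(\<lambda>\<omega>. restrict (\<lambda>i. D i \<omega>) {..<n}) -` F \<inter> space M = a"
  proof (intro equalityI subsetI)
    fix \<omega> assume *: "\<omega> \<in> (\<lambda>\<omega>. restrict (\<lambda>i. D i \<omega>) {..<n}) -` F \<inter> space M"
    have "X s \<omega> \<in> B s" if "s \<in> I" for s
    proof -
      have "s \<in> set l" using that l(2) by (simp add: J_def)
      then obtain j where j: "j \<le> n" "l ! j = s"
        using n by (auto simp: in_set_conv_nth less_Suc_eq_le)
      then have "(\<Sum>i<j. D i \<omega>) \<in> B s"
        using * that by (auto simp: F_def)
      then show ?thesis using X_sum[OF j(1)] j(2) * by auto
    qed
    then show "\<omega> \<in> a" using * by (auto simp: a(1))
  next
    fix \<omega> assume \<omega>: "\<omega> \<in> a"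
    then have "\<omega> \<in> space M" by (simp add: a(1))
    then have "(\<Sum>i<j. restrict (\<lambda>i. D i \<omega>) {..<n} i) = X (l ! j) \<omega>" if "j \<le> n" for j
      using X_sum[OF that] that by (auto intro!: sum.cong)
    then show "\<omega> \<in> (\<lambda>\<omega>. restrict (\<lambda>i. D i \<omega>) {..<n}) -` F \<inter> space M"
      using \<omega> by (auto simp: F_def a(1) space_PiM)
  qed
  have eqG: "(\<lambda>\<omega>. restrict (\<lambda>i. D i \<omega>) {n}) -` G \<inter> space M = b"
    by (auto simp: G_def b(1) D_def tt_def ln space_PiM)
  have "(\<lambda>\<omega>. (restrict (\<lambda>i. D i \<omega>) {..<n}, restrict (\<lambda>i. D i \<omega>) {n})) -` (F \<times> G) \<inter> space M =
      ((\<lambda>\<omega>. restrict (\<lambda>i. D i \<omega>) {..<n}) -` F \<inter> space M) \<inter> ((\<lambda>\<omega>. restrict (\<lambda>i. D i \<omega>) {n}) -` G \<inter> space M)"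
    by auto
  then show "prob (a \<inter> b) = prob a * prob b"
    using indep_varD[OF ind F G] unfolding eqF eqG by simp
qed

lemma natural_filtration_subset_cylinders:
  "natural_filtration M X t \<subseteq> sigma_sets (space M) (cylinders t)"
  unfolding natural_filtration_def
proof (rule sigma_sets_mono, safe)
  fix s B assume "0 \<le> s" "s \<le> t" and B: "B \<in> sets (borel :: real measure)"
  have "X s -` B \<inter> space M = {\<omega>\<in>space M. \<forall>s'\<in>{s}. X s' \<omega> \<in> B}"
    by auto
  then have "X s -` B \<inter> space M \<in> cylinders t"
    unfolding cylinders_def using \<open>0 \<le> s\<close> \<open>s \<le> t\<close> B
    by (intro CollectI exI[of _ "{s}"] exI[of _ "\<lambda>_. B"]) auto
  then show "X s -` B \<inter> space M \<in> sigma_sets (space M) (cylinders t)"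
    by (rule sigma_sets.Basic)
qed

lemma natural_filtration_events: "natural_filtration M X t \<subseteq> events"
  unfolding natural_filtration_def by (intro sets.sigma_sets_subset) auto

text \<open>The natural filtration as an object of type \<open>measure\<close>, so that it can be a
  factor of a product space.\<close>

definition past :: "real \<Rightarrow> 'a measure" where
  "past t = sigma (space M) (natural_filtration M X t)"

lemma space_past [simp]: "space (past t) = space M"
  and sets_past: "sets (past t) = natural_filtration M X t"
proof -
  have *: "{X s -` B \<inter> space M | s B. 0 \<le> s \<and> s \<le> t \<and> B \<in> sets borel} \<subseteq> Pow (space M)" by auto
  interpret S: sigma_algebra "space M" "natural_filtration M X t"
    unfolding natural_filtration_def by (rule sigma_algebra_sigma_sets[OF *])
  show "space (past t) = space M" unfolding past_def by (simp add: S.space_closed space_measure_of)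
  show "sets (past t) = natural_filtration M X t"
    unfolding past_def by (simp add: S.sets_measure_of_eq)
qed

lemma X_measurable_past: "0 \<le> t \<Longrightarrow> X t \<in> borel_measurable (past t)"
  unfolding measurable_def sets_past natural_filtration_def
  by (auto intro!: sigma_sets.Basic)

lemma prob_past_increment:
  assumes "0 \<le> t" "0 < h" "A \<in> natural_filtration M X t" "C \<in> sets borel"
  shows "prob (A \<inter> ((\<lambda>\<omega>. X (t + h) \<omega> - X t \<omega>) -` C \<inter> space M)) =
    prob A * prob ((\<lambda>\<omega>. X (t + h) \<omega> - X t \<omega>) -` C \<inter> space M)"
proof (rule indep_setD)
  show "indep_set (sigma_sets (space M) (cylinders t)) (sigma_sets (space M) (increment_sets t h))"
    by (intro indep_set_sigma_sets indep_cylinders_increment Int_stable_cylinders Int_stable_increment_sets assms)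
  show "A \<in> sigma_sets (space M) (cylinders t)"
    using natural_filtration_subset_cylinders assms by auto
  show "(\<lambda>\<omega>. X (t + h) \<omega> - X t \<omega>) -` C \<inter> space M \<in> sigma_sets (space M) (increment_sets t h)"
    using assms(4) by (intro sigma_sets.Basic) (auto simp: increment_sets_def)
qed

lemma measurable_past: "(\<lambda>\<omega>. \<omega>) \<in> measurable M (past t)"
proof (rule measurableI)
  fix A assume A: "A \<in> sets (past t)"
  then have "A \<in> events"
    using natural_filtration_events by (auto simp: sets_past)
  moreover have "(\<lambda>\<omega>. \<omega>) -` A \<inter> space M = A"
    using sets.sets_into_space[OF A] by auto
  ultimately show "(\<lambda>\<omega>. \<omega>) -` A \<inter> space M \<in> events" by simp
qed simp

text \<open>Independence as a product law: the identity map, viewed as a variable with values in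
  \<open>past t\<close>, records everything known at \<open>t\<close>. Checking rectangles suffices,
  and Fubini can then take the place of conditional expectation.\<close>

lemma distr_past_increment:
  assumes "0 \<le> t" "0 < h"
  shows "distr M (past t) (\<lambda>\<omega>. \<omega>) \<Otimes>\<^sub>M distr M borel (X h) =
    distr M (past t \<Otimes>\<^sub>M borel) (\<lambda>\<omega>. (\<omega>, X (t + h) \<omega> - X t \<omega>))"
proof -
  note measurable_past [measurable]
  define D where "D = (\<lambda>\<omega>. X (t + h) \<omega> - X t \<omega>)"
  have [measurable]: "D \<in> borel_measurable M"
    unfolding D_def by measurable
  have XD: "distr M borel (X h) = distr M borel D"
    unfolding D_def using assms by (intro increments_stationary[symmetric]) auto
  interpret P: prob_space "distr M (past t) (\<lambda>\<omega>. \<omega>)"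
    by (rule prob_space_distr) measurable
  interpret Q: prob_space "distr M borel D"
    by (rule prob_space_distr) measurable
  have "distr M (past t) (\<lambda>\<omega>. \<omega>) \<Otimes>\<^sub>M distr M borel D = distr M (past t \<Otimes>\<^sub>M borel) (\<lambda>\<omega>. (\<omega>, D \<omega>))"
  proof (rule pair_measure_eqI)
    show "sigma_finite_measure (distr M (past t) (\<lambda>\<omega>. \<omega>))" "sigma_finite_measure (distr M borel D)"
      by unfold_locales
    show "sets (distr M (past t) (\<lambda>\<omega>. \<omega>) \<Otimes>\<^sub>M distr M borel D) =
        sets (distr M (past t \<Otimes>\<^sub>M borel) (\<lambda>\<omega>. (\<omega>, D \<omega>)))"
      by (simp cong: sets_pair_measure_cong)
    fix A C assume "A \<in> sets (distr M (past t) (\<lambda>\<omega>. \<omega>))" "C \<in> sets (distr M borel D)"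
    then have A: "A \<in> sets (past t)" and C: "C \<in> sets borel" by auto
    have A': "A \<in> natural_filtration M X t" "A \<in> events" "A \<subseteq> space M"
      using A natural_filtration_events[of t] sets.sets_into_space[OF A] by (auto simp: sets_past)
    have "emeasure (distr M (past t) (\<lambda>\<omega>. \<omega>)) A = emeasure M A"
      using A A'(3) by (subst emeasure_distr) (auto simp: Int_absorb2)
    moreover have "emeasure (distr M borel D) C = emeasure M (D -` C \<inter> space M)"
      using C by (subst emeasure_distr) auto
    moreover have "emeasure (distr M (past t \<Otimes>\<^sub>M borel) (\<lambda>\<omega>. (\<omega>, D \<omega>))) (A \<times> C) = emeasure M (A \<inter> (D -` C \<inter> space M))"
      using A C A'(3) by (subst emeasure_distr) (auto intro!: arg_cong[where f = "emeasure M"])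
    ultimately show "emeasure (distr M (past t) (\<lambda>\<omega>. \<omega>)) A * emeasure (distr M borel D) C =
        emeasure (distr M (past t \<Otimes>\<^sub>M borel) (\<lambda>\<omega>. (\<omega>, D \<omega>))) (A \<times> C)"
      using prob_past_increment[OF assms A'(1) C, folded D_def]
      by (simp add: emeasure_eq_measure ennreal_mult[symmetric])
  qed
  then show ?thesis
    unfolding XD D_def .
qed

text \<open>The submartingale inequality for gauss_bump(X_t) + C t, tested on an event of the past:
  for fixed \<omega> the increment is integrated out, and the one-step bound is applied at y = X t
  \<omega>.\<close>

lemma gauss_bump_step_on_past:
  assumes C: "\<And>h y. 0 \<le> h \<Longrightarrow> (\<integral>\<omega>. gauss_bump (y + X h \<omega>) \<partial>M) \<ge> gauss_bump y - C * h"
    and t: "0 \<le> t" "0 < h" and A: "A \<in> natural_filtration M X t"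
  shows "0 \<le> (\<integral>\<omega>. indicator A \<omega> * (gauss_bump (X (t + h) \<omega>) - gauss_bump (X t \<omega>) + C * h) \<partial>M)"
proof -
  note measurable_past [measurable]
  have A' [measurable]: "A \<in> sets (past t)" "A \<in> events"
    using A natural_filtration_events[of t] by (auto simp: sets_past)
  have [measurable]: "X t \<in> borel_measurable (past t)"
    using t by (intro X_measurable_past)
  let ?P = "distr M (past t) (\<lambda>\<omega>. \<omega>)" and ?Q = "distr M borel (X h)"
  interpret P: prob_space ?P by (rule prob_space_distr) measurable
  interpret Q: prob_space ?Q by (rule prob_space_distr) measurable
  interpret PQ: pair_prob_space ?P ?Q ..
  define f where "f = (\<lambda>(\<omega>, d). indicator A \<omega> * (gauss_bump (X t \<omega> + d) - gauss_bump (X t \<omega>) + C * h))"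
  have f_meas [measurable]: "f \<in> borel_measurable (past t \<Otimes>\<^sub>M borel)"
    unfolding f_def by measurable
  have bd: "\<bar>gauss_bump x - gauss_bump y + C * h\<bar> \<le> 2 + \<bar>C * h\<bar>" for x y
    using gauss_bump_bounds(1,3)[of x] gauss_bump_bounds(1,3)[of y] by linarith
  have bdA: "\<bar>indicator A \<omega> * (gauss_bump x - gauss_bump y + C * h)\<bar> \<le> 2 + \<bar>C * h\<bar>" for x y \<omega>
    using bd[of x y] by (auto simp: indicator_def)
  have int: "integrable (?P \<Otimes>\<^sub>M ?Q) f"
    by (rule PQ.integrable_const_bound[where B = "2 + \<bar>C * h\<bar>"])
       (auto simp: f_def bdA cong: measurable_cong_sets)
  have "(\<integral>\<omega>. indicator A \<omega> * (gauss_bump (X (t + h) \<omega>) - gauss_bump (X t \<omega>) + C * h) \<partial>M) =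
      (\<integral>\<omega>. f (\<omega>, X (t + h) \<omega> - X t \<omega>) \<partial>M)"
    by (simp add: f_def)
  also have "\<dots> = (\<integral>z. f z \<partial>(?P \<Otimes>\<^sub>M ?Q))"
    unfolding distr_past_increment[OF t] by (subst integral_distr) auto
  also have "\<dots> = (\<integral>\<omega>. (\<integral>d. f (\<omega>, d) \<partial>?Q) \<partial>?P)"
    by (rule PQ.integral_fst'[OF int, symmetric])
  also have "\<dots> \<ge> 0"
  proof (rule integral_nonneg_AE, rule AE_I2)
    fix \<omega>
    have i: "integrable ?Q (\<lambda>d. gauss_bump (X t \<omega> + d))"
      by (rule Q.integrable_const_bound[where B = 2]) (use gauss_bump_bounds in auto)
    have "(\<integral>d. f (\<omega>, d) \<partial>?Q) = indicator A \<omega> * (\<integral>d. gauss_bump (X t \<omega> + d) - gauss_bump (X t \<omega>) + C * h \<partial>?Q)"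
      by (simp add: f_def)
    also have "(\<integral>d. gauss_bump (X t \<omega> + d) - gauss_bump (X t \<omega>) + C * h \<partial>?Q) =
        (\<integral>d. gauss_bump (X t \<omega> + d) \<partial>?Q) - gauss_bump (X t \<omega>) + C * h"
      using i Q.prob_space by simp
    also have "(\<integral>d. gauss_bump (X t \<omega> + d) \<partial>?Q) = (\<integral>\<omega>'. gauss_bump (X t \<omega> + X h \<omega>') \<partial>M)"
      by (simp add: integral_distr)
    finally show "0 \<le> (\<integral>d. f (\<omega>, d) \<partial>?Q)"
      using C[of h "X t \<omega>"] t by simp
  qed
  finally show ?thesis .
qed

section \<open>From the natural filtration to its augmentation\<close>

text \<open>The sets that differ from a member of the filtration inside a null set are closed under
  complements and countable unions, and they include all generators.\<close>

lemma augmented_approx: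
  assumes "A \<in> sigma_sets (space M) (natural_filtration M X t \<union> aug_null_sets M)"
  shows "\<exists>B\<in>natural_filtration M X t. \<exists>N\<in>null_sets M. (A - B) \<union> (B - A) \<subseteq> N"
  using assms
proof (induction rule: sigma_sets.induct)
  case (Basic a)
  have "{} \<in> natural_filtration M X t"
    unfolding natural_filtration_def by (rule sigma_sets.Empty)
  moreover have "{} \<in> null_sets M" by simp
  ultimately show ?case
    using Basic unfolding aug_null_sets_def by blast
next
  case Empty
  have "{} \<in> natural_filtration M X t"
    unfolding natural_filtration_def by (rule sigma_sets.Empty)
  then show ?case by auto
next
  case (Compl a)
  then obtain B N where B: "B \<in> natural_filtration M X t" "N \<in> null_sets M" "(a - B) \<union> (B - a) \<subseteq> N"
    by auto
  have "space M - B \<in> natural_filtration M X t"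
    using B(1) unfolding natural_filtration_def by (rule sigma_sets.Compl)
  then show ?case
    using B by (intro bexI[of _ "space M - B"] bexI[of _ N]) auto
next
  case (Union a)
  then obtain B N where B: "\<And>i. B i \<in> natural_filtration M X t" "\<And>i. N i \<in> null_sets M"
      "\<And>i::nat. (a i - B i) \<union> (B i - a i) \<subseteq> N i"
    by metis
  have "(\<Union>i. B i) \<in> natural_filtration M X t"
    using B(1) unfolding natural_filtration_def by (rule sigma_sets.Union)
  moreover have "(\<Union>i. N i) \<in> null_sets M"
    using B(2) by auto
  moreover have "((\<Union>i. a i) - (\<Union>i. B i)) \<union> ((\<Union>i. B i) - (\<Union>i. a i)) \<subseteq> (\<Union>i. N i)"
    using B(3) by blast
  ultimately show ?case by blast
qed

text \<open>Replacing the event by one of the natural filtration changes its indicator only on a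
  null set, so the integral over the completion is the one already estimated.\<close>

lemma gauss_bump_step_augmented:
  assumes C: "\<And>h y. 0 \<le> h \<Longrightarrow> (\<integral>\<omega>. gauss_bump (y + X h \<omega>) \<partial>M) \<ge> gauss_bump y - C * h"
    and t: "0 \<le> t" "0 < h"
    and A: "A \<in> sigma_sets (space M) (natural_filtration M X t \<union> aug_null_sets M)"
  shows "A \<in> sets (completion M)"
    and "0 \<le> (\<integral>\<omega>. indicator A \<omega> * (gauss_bump (X (t + h) \<omega>) - gauss_bump (X t \<omega>) + C * h) \<partial>completion M)"
proof -
  obtain B N where B: "B \<in> natural_filtration M X t" "N \<in> null_sets M" "(A - B) \<union> (B - A) \<subseteq> N"
    using augmented_approx[OF A] by auto
  have [measurable]: "B \<in> events"
    using B natural_filtration_events by auto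
  have N: "N \<in> null_sets (completion M)"
    using B(2) by (rule null_sets_completionI)
  then have AE: "AE \<omega> in completion M. indicator A \<omega> = (indicator B \<omega> :: real)"
    by (rule AE_I') (use B(3) in \<open>auto simp: indicator_def split: if_splits\<close>)
  have "A = (B - (B - A)) \<union> (A - B)" by auto
  moreover have "B - A \<in> sets (completion M)" "A - B \<in> sets (completion M)"
    using null_sets_completion_subset[OF _ N] B(3) by (auto intro!: null_setsD2)
  ultimately show A' [measurable]: "A \<in> sets (completion M)"
    using \<open>B \<in> events\<close> by (metis sets.Diff sets.Un sets_completionI_sets)
  have "(\<integral>\<omega>. indicator A \<omega> * (gauss_bump (X (t + h) \<omega>) - gauss_bump (X t \<omega>) + C * h) \<partial>completion M) =
    (\<integral>\<omega>. indicator B \<omega> * (gauss_bump (X (t + h) \<omega>) - gauss_bump (X t \<omega>) + C * h) \<partial>completion M)"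
  proof (rule integral_cong_AE)
    have [measurable]: "X t' \<in> borel_measurable (completion M)" for t'
      by (intro measurable_completion) measurable
    have [measurable]: "B \<in> sets (completion M)" by simp
    show "(\<lambda>\<omega>. indicator A \<omega> * (gauss_bump (X (t + h) \<omega>) - gauss_bump (X t \<omega>) + C * h)) \<in> borel_measurable (completion M)"
      by measurable
    show "(\<lambda>\<omega>. indicator B \<omega> * (gauss_bump (X (t + h) \<omega>) - gauss_bump (X t \<omega>) + C * h)) \<in> borel_measurable (completion M)"
      by measurable
  qed (use AE in \<open>auto elim!: eventually_mono\<close>)
  also have "\<dots> = (\<integral>\<omega>. indicator B \<omega> * (gauss_bump (X (t + h) \<omega>) - gauss_bump (X t \<omega>) + C * h) \<partial>M)"
    by (rule integral_completion) measurable
  also have "\<dots> \<ge> 0"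
    by (rule gauss_bump_step_on_past[OF C t B(1)])
  finally show "0 \<le> (\<integral>\<omega>. indicator A \<omega> * (gauss_bump (X (t + h) \<omega>) - gauss_bump (X t \<omega>) + C * h) \<partial>completion M)" .
qed

section \<open>Stopping times and their discretization\<close>

lemma prob_space_completion: "prob_space (completion M)"
  by (rule prob_spaceI) (simp add: emeasure_space_1)

text \<open>The event {\<tau> \<le> t} lies in the augmented past of every later time, here t + 1,
  hence in the completion.\<close>

lemma stopping_time_measurable:
  assumes "\<tau> \<in> stopping_times_upto M X s"
  shows "\<tau> \<in> borel_measurable (completion M)"
  unfolding borel_measurable_iff_le space_completion
proof
  fix t
  show "{\<omega>\<in>space M. \<tau> \<omega> \<le> t} \<in> sets (completion M)"
  proof (cases "0 \<le> t")
    case True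
    then have "{\<omega>\<in>space M. \<tau> \<omega> \<le> t} \<in> sigma_sets (space M) (natural_filtration M X (t + 1) \<union> aug_null_sets M)"
      using assms by (auto simp: stopping_times_upto_def usual_augmentation_def)
    moreover obtain C where "C \<ge> 0" and C: "\<And>h y. 0 \<le> h \<Longrightarrow> (\<integral>\<omega>. gauss_bump (y + X h \<omega>) \<partial>M) \<ge> gauss_bump y - C * h"
      using gauss_bump_one_step by auto
    ultimately show ?thesis
      using True by (intro gauss_bump_step_augmented(1)[OF C, where t = "t + 1" and h = 1]) auto
  next
    case False
    then have "{\<omega>\<in>space M. \<tau> \<omega> \<le> t} = {}"
      using assms by (fastforce simp: stopping_times_upto_def)
    then show ?thesis by (simp only: sets.empty_sets)
  qed
qed

text \<open>The stopping time is rounded up to the grid of mesh \<open>1/n\<close> and then shifted by one more cell: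
  this absorbs the right limit in the usual augmentation, since \<open>{\<tau> \<le> k/n}\<close> is only known to lie in
  the (augmented) past of strictly later times.\<close>

definition grid_index :: "('a \<Rightarrow> real) \<Rightarrow> nat \<Rightarrow> 'a \<Rightarrow> nat" where
  "grid_index \<tau> n \<omega> = Suc (nat \<lceil>\<tau> \<omega> * real n\<rceil>)"

lemma grid_index_bounds:
  assumes "0 \<le> \<tau> \<omega>" "0 < n"
  shows "\<tau> \<omega> < grid_index \<tau> n \<omega> / n" "grid_index \<tau> n \<omega> / n \<le> \<tau> \<omega> + 2 / n"
proof -
  have c: "0 \<le> \<lceil>\<tau> \<omega> * real n\<rceil>"
    using assms by (simp add: order_less_le_trans[of "-1" 0])
  then have eq: "real (grid_index \<tau> n \<omega>) = of_int \<lceil>\<tau> \<omega> * real n\<rceil> + 1"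
    by (simp add: grid_index_def)
  have "\<tau> \<omega> * real n < of_int \<lceil>\<tau> \<omega> * real n\<rceil> + 1" "of_int \<lceil>\<tau> \<omega> * real n\<rceil> + 1 \<le> \<tau> \<omega> * real n + 2"
    using ceiling_correct[of "\<tau> \<omega> * real n"] by linarith+
  then show "\<tau> \<omega> < grid_index \<tau> n \<omega> / n" "grid_index \<tau> n \<omega> / n \<le> \<tau> \<omega> + 2 / n"
    unfolding eq using assms(2) by (simp_all add: pos_less_divide_eq pos_divide_le_eq distrib_right)
qed

text \<open>For k = j + 1 this is the event {\<tau> > j/n}. The extra cell makes k/n strictly later
  than j/n, so the intersection defining the augmentation at j/n can be instantiated at k/n.\<close>

lemma grid_index_gt_past:
  assumes \<tau>: "\<tau> \<in> stopping_times_upto M X s" and n: "0 < n"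
  shows "{\<omega>\<in>space M. k < grid_index \<tau> n \<omega>} \<in>
    sigma_sets (space M) (natural_filtration M X (real k / real n) \<union> aug_null_sets M)"
proof (cases k)
  case 0
  then have "{\<omega>\<in>space M. k < grid_index \<tau> n \<omega>} = space M"
    by (auto simp: grid_index_def)
  then show ?thesis by (simp add: sigma_sets_top)
next
  case (Suc j)
  have "{\<omega>\<in>space M. k < grid_index \<tau> n \<omega>} = space M - {\<omega>\<in>space M. \<tau> \<omega> \<le> real j / real n}"
  proof -
    have "k < grid_index \<tau> n \<omega> \<longleftrightarrow> \<not> \<tau> \<omega> \<le> real j / real n" if "\<omega> \<in> space M" for \<omega>
    proof -
      have "k < grid_index \<tau> n \<omega> \<longleftrightarrow> int j < \<lceil>\<tau> \<omega> * real n\<rceil>"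
        by (auto simp: Suc grid_index_def zless_nat_eq_int_zless)
      also have "\<dots> \<longleftrightarrow> real j < \<tau> \<omega> * real n"
        by (simp add: less_ceiling_iff)
      finally show ?thesis
        using n by (auto simp: field_simps)
    qed
    then show ?thesis by auto
  qed
  moreover have "{\<omega>\<in>space M. \<tau> \<omega> \<le> real j / real n} \<in> usual_augmentation M X (real j / real n)"
    using \<tau> by (auto simp: stopping_times_upto_def)
  then have "{\<omega>\<in>space M. \<tau> \<omega> \<le> real j / real n} \<in>
      sigma_sets (space M) (natural_filtration M X (real k / real n) \<union> aug_null_sets M)"
    using n unfolding usual_augmentation_def by (auto simp: Suc divide_strict_right_mono)
  ultimately show ?thesis
    by (simp add: sigma_sets.Compl)
qed

text \<open>Optional sampling by telescoping: the bump at the grid time is 1 - C \<kappa>/n plus the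
  sum over k of the compensated steps on {k < \<kappa>}. Each step has nonnegative expectation
  because this event lies in the augmented past of k/n; then \<kappa>/n \<le> \<tau> + 2/n.\<close>

lemma gauss_bump_grid:
  assumes C: "\<And>h y. 0 \<le> h \<Longrightarrow> (\<integral>\<omega>. gauss_bump (y + X h \<omega>) \<partial>M) \<ge> gauss_bump y - C * h"
    and "0 \<le> C" and \<tau>: "\<tau> \<in> stopping_times_upto M X s" and n: "0 < n"
  shows "(\<lambda>\<omega>. gauss_bump (X (grid_index \<tau> n \<omega> / n) \<omega>)) \<in> borel_measurable (completion M)"
    and "1 - C * ((\<integral>\<omega>. \<tau> \<omega> \<partial>completion M) + 2 / n) \<le>
      (\<integral>\<omega>. gauss_bump (X (grid_index \<tau> n \<omega> / n) \<omega>) \<partial>completion M)"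
proof -
  interpret cM: prob_space "completion M" by (rule prob_space_completion)
  let ?\<kappa> = "grid_index \<tau> n"
  define h where "h = 1 / real n"
  have h: "0 < h" using n by (simp add: h_def)
  have [measurable]: "\<tau> \<in> borel_measurable (completion M)"
    by (rule stopping_time_measurable[OF \<tau>])
  have [measurable]: "X t \<in> borel_measurable (completion M)" for t
    by (intro measurable_completion) measurable
  have \<tau>_bd: "0 \<le> \<tau> \<omega>" "\<tau> \<omega> \<le> s" if "\<omega> \<in> space M" for \<omega>
    using \<tau> that by (auto simp: stopping_times_upto_def)
  define A where "A k = {\<omega>\<in>space M. k < ?\<kappa> \<omega>}" for k
  \<comment> \<open>A deterministic bound for the grid index, so that the telescoped sum has a fixed
    finite range.\<close>
  define m where "m = Suc (nat \<lceil>s * real n\<rceil>)"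
  have \<kappa>_le: "?\<kappa> \<omega> \<le> m" if "\<omega> \<in> space M" for \<omega>
    unfolding grid_index_def m_def using \<tau>_bd[OF that]
    by (intro Suc_le_mono[THEN iffD2] nat_mono ceiling_mono mult_right_mono) auto
  define Y where "Y k \<omega> = indicator (A k) \<omega> * (gauss_bump (X (real k / n + h) \<omega>) - gauss_bump (X (real k / n) \<omega>) + C * h)" for k \<omega>
  have A: "A k \<in> sigma_sets (space M) (natural_filtration M X (real k / real n) \<union> aug_null_sets M)" for k
    unfolding A_def by (rule grid_index_gt_past[OF \<tau> n])
  have A_meas [measurable]: "A k \<in> sets (completion M)" for k
    by (rule gauss_bump_step_augmented(1)[OF C _ h A]) auto
  have Y_meas [measurable]: "Y k \<in> borel_measurable (completion M)" for k
    unfolding Y_def by measurable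
  have Y_int: "integrable (completion M) (Y k)" for k
  proof (rule cM.integrable_const_bound[where B = "2 + C * h"])
    show "AE \<omega> in completion M. norm (Y k \<omega>) \<le> 2 + C * h"
    proof (rule AE_I2)
      fix \<omega>
      have "0 \<le> C * h" using \<open>0 \<le> C\<close> h by simp
      moreover have "0 \<le> gauss_bump (X (real k / n + h) \<omega>)" "gauss_bump (X (real k / n + h) \<omega>) \<le> 2"
          "0 \<le> gauss_bump (X (real k / n) \<omega>)" "gauss_bump (X (real k / n) \<omega>) \<le> 2"
        by (auto simp: gauss_bump_bounds)
      ultimately show "norm (Y k \<omega>) \<le> 2 + C * h"
        by (auto simp: Y_def indicator_def)
    qed
  qed measurable
  have telescope: "gauss_bump (X (?\<kappa> \<omega> / n) \<omega>) = 1 - C * (?\<kappa> \<omega> / n) + (\<Sum>k<m. Y k \<omega>)" if \<omega>: "\<omega> \<in> space M" for \<omega>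
  proof -
    have "(\<Sum>k<m. Y k \<omega>) = (\<Sum>k<?\<kappa> \<omega>. Y k \<omega>)"
      using \<kappa>_le[OF \<omega>] by (intro sum.mono_neutral_right) (auto simp: Y_def A_def)
    also have "\<dots> = (\<Sum>k<?\<kappa> \<omega>. gauss_bump (X (real (Suc k) / n) \<omega>) - gauss_bump (X (real k / n) \<omega>) + C * h)"
      using \<omega> by (intro sum.cong) (auto simp: Y_def A_def h_def add_divide_distrib add.commute)
    also have "\<dots> = (\<Sum>k<?\<kappa> \<omega>. gauss_bump (X (real (Suc k) / n) \<omega>) - gauss_bump (X (real k / n) \<omega>)) + ?\<kappa> \<omega> * (C * h)"
      by (simp add: sum.distrib del: of_nat_Suc)
    also have "(\<Sum>k<?\<kappa> \<omega>. gauss_bump (X (real (Suc k) / n) \<omega>) - gauss_bump (X (real k / n) \<omega>)) =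
        gauss_bump (X (real (?\<kappa> \<omega>) / n) \<omega>) - gauss_bump (X (real 0 / n) \<omega>)"
      by (rule sum_lessThan_telescope)
    finally show ?thesis
      using X_0[OF \<omega>] by (simp add: gauss_bump_0 h_def)
  qed
  have \<kappa>_meas [measurable]: "(\<lambda>\<omega>. real (?\<kappa> \<omega>)) \<in> borel_measurable (completion M)"
    unfolding grid_index_def by measurable
  \<comment> \<open>X is evaluated at a random time; measurability is read off the telescoped form,
    where only deterministic times occur.\<close>
  show meas: "(\<lambda>\<omega>. gauss_bump (X (?\<kappa> \<omega> / n) \<omega>)) \<in> borel_measurable (completion M)"
    by (subst measurable_cong[OF telescope]) auto
  have \<kappa>_int: "integrable (completion M) (\<lambda>\<omega>. real (?\<kappa> \<omega>) / n)"
    by (rule cM.integrable_const_bound[where B = "real m / n"])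
       (use \<kappa>_le n in \<open>auto intro!: AE_I2 divide_right_mono\<close>)
  have \<tau>_int: "integrable (completion M) \<tau>"
    by (rule cM.integrable_const_bound[where B = s]) (use \<tau>_bd in auto)
  have "(\<integral>\<omega>. real (?\<kappa> \<omega>) / n \<partial>completion M) \<le> (\<integral>\<omega>. \<tau> \<omega> + 2 / n \<partial>completion M)"
    using \<kappa>_int \<tau>_int grid_index_bounds(2)[OF \<tau>_bd(1) n] by (intro integral_mono) auto
  also have "\<dots> = (\<integral>\<omega>. \<tau> \<omega> \<partial>completion M) + 2 / n"
    using \<tau>_int cM.prob_space by simp
  finally have \<kappa>_le': "C * (\<integral>\<omega>. real (?\<kappa> \<omega>) / n \<partial>completion M) \<le> C * ((\<integral>\<omega>. \<tau> \<omega> \<partial>completion M) + 2 / n)"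
    using \<open>0 \<le> C\<close> by (rule mult_left_mono)
  have "0 \<le> (\<Sum>k<m. \<integral>\<omega>. Y k \<omega> \<partial>completion M)"
    unfolding Y_def by (intro sum_nonneg gauss_bump_step_augmented(2)[OF C _ h A]) auto
  also have "\<dots> = (\<integral>\<omega>. (\<Sum>k<m. Y k \<omega>) \<partial>completion M)"
    using Y_int by simp
  finally have "1 - C * (\<integral>\<omega>. real (?\<kappa> \<omega>) / n \<partial>completion M) \<le>
      1 - C * (\<integral>\<omega>. real (?\<kappa> \<omega>) / n \<partial>completion M) + (\<integral>\<omega>. (\<Sum>k<m. Y k \<omega>) \<partial>completion M)"
    by simp
  also have "\<dots> = (\<integral>\<omega>. 1 - C * (real (?\<kappa> \<omega>) / n) + (\<Sum>k<m. Y k \<omega>) \<partial>completion M)"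
  proof -
    have "integrable (completion M) (\<lambda>\<omega>. \<Sum>k<m. Y k \<omega>)"
      using Y_int by simp
    moreover have "integrable (completion M) (\<lambda>\<omega>. C * (real (?\<kappa> \<omega>) / n))"
      using \<kappa>_int by (rule integrable_mult_right)
    moreover have "(\<integral>\<omega>. C * (real (?\<kappa> \<omega>) / n) \<partial>completion M) = C * (\<integral>\<omega>. real (?\<kappa> \<omega>) / n \<partial>completion M)"
      by (rule integral_mult_right_zero)
    ultimately show ?thesis
      using cM.prob_space by (simp only: Bochner_Integration.integral_add Bochner_Integration.integral_diff
          Bochner_Integration.integrable_diff integrable_const cM.integrable_const lebesgue_integral_const) simp
  qed
  also have "\<dots> = (\<integral>\<omega>. gauss_bump (X (?\<kappa> \<omega> / n) \<omega>) \<partial>completion M)"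
    by (intro Bochner_Integration.integral_cong refl) (simp add: telescope)
  finally show "1 - C * ((\<integral>\<omega>. \<tau> \<omega> \<partial>completion M) + 2 / n) \<le> (\<integral>\<omega>. gauss_bump (X (?\<kappa> \<omega> / n) \<omega>) \<partial>completion M)"
    using \<kappa>_le' by linarith
qed

text \<open>The grid times approach \<tau> strictly from the right, which is what right-continuity
  of the paths requires.\<close>

lemma grid_index_tendsto:
  assumes "0 \<le> \<tau> \<omega>"
  shows "filterlim (\<lambda>n. grid_index \<tau> (Suc n) \<omega> / Suc n) (at_right (\<tau> \<omega>)) sequentially"
  unfolding filterlim_at
proof
  have b: "\<tau> \<omega> < grid_index \<tau> (Suc n) \<omega> / Suc n" "grid_index \<tau> (Suc n) \<omega> / Suc n \<le> \<tau> \<omega> + 2 / Suc n" for n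
    by (rule grid_index_bounds[of \<tau> \<omega> "Suc n", OF assms]; simp)+
  show "\<forall>\<^sub>F n in sequentially. grid_index \<tau> (Suc n) \<omega> / Suc n \<in> {\<tau> \<omega><..} \<and> grid_index \<tau> (Suc n) \<omega> / Suc n \<noteq> \<tau> \<omega>"
    using b(1) by (auto intro!: always_eventually simp: less_imp_neq[symmetric] simp del: of_nat_Suc)
  have "(\<lambda>n. \<tau> \<omega> + 2 * inverse (real (Suc n))) \<longlonglongrightarrow> \<tau> \<omega> + 2 * 0"
    by (intro tendsto_intros LIMSEQ_inverse_real_of_nat)
  then have lim: "(\<lambda>n. \<tau> \<omega> + 2 / real (Suc n)) \<longlonglongrightarrow> \<tau> \<omega>"
    by (simp add: divide_inverse del: of_nat_Suc)
  show "(\<lambda>n. grid_index \<tau> (Suc n) \<omega> / Suc n) \<longlonglongrightarrow> \<tau> \<omega>"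
    by (rule real_tendsto_sandwich[OF always_eventually always_eventually tendsto_const lim])
       (use b less_imp_le in blast)+
qed

text \<open>The grid inequality passes to the limit by right-continuity and dominated convergence,
  the bump being at most 2. A measurable representative \<open>L\<close> is returned, since the
  paths are right-continuous only almost surely.\<close>

lemma gauss_bump_stopped:
  assumes C: "\<And>h y. 0 \<le> h \<Longrightarrow> (\<integral>\<omega>. gauss_bump (y + X h \<omega>) \<partial>M) \<ge> gauss_bump y - C * h"
    and "0 \<le> C" and \<tau>: "\<tau> \<in> stopping_times_upto M X s"
  obtains L where "integrable (completion M) L" "AE \<omega> in completion M. L \<omega> = gauss_bump (X (\<tau> \<omega>) \<omega>)"
    "1 - C * (\<integral>\<omega>. \<tau> \<omega> \<partial>completion M) \<le> (\<integral>\<omega>. L \<omega> \<partial>completion M)"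
proof -
  interpret cM: prob_space "completion M" by (rule prob_space_completion)
  define G where "G n \<omega> = gauss_bump (X (grid_index \<tau> (Suc n) \<omega> / Suc n) \<omega>)" for n \<omega>
  \<comment> \<open>A pointwise limit of measurable functions, hence measurable; it agrees with the
    stopped bump wherever the path is right-continuous.\<close>
  define L where "L \<omega> = lim (\<lambda>n. G n \<omega>)" for \<omega>
  have G_meas [measurable]: "G n \<in> borel_measurable (completion M)" for n
    unfolding G_def by (rule gauss_bump_grid(1)[OF C \<open>0 \<le> C\<close> \<tau>]) auto
  have L_meas [measurable]: "L \<in> borel_measurable (completion M)"
    unfolding L_def by (intro borel_measurable_lim_metric) measurable
  have lim: "AE \<omega> in completion M. (\<lambda>n. G n \<omega>) \<longlonglongrightarrow> gauss_bump (X (\<tau> \<omega>) \<omega>)"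
    using AE_completion[OF X_right_continuous] AE_space
  proof eventually_elim
    case (elim \<omega>)
    then have \<tau>0: "0 \<le> \<tau> \<omega>"
      using \<tau> by (auto simp: stopping_times_upto_def)
    then have "((\<lambda>s. X s \<omega>) \<longlongrightarrow> X (\<tau> \<omega>) \<omega>) (at_right (\<tau> \<omega>))"
      using elim by (auto simp: continuous_within)
    then have "(\<lambda>n. X (grid_index \<tau> (Suc n) \<omega> / Suc n) \<omega>) \<longlonglongrightarrow> X (\<tau> \<omega>) \<omega>"
      by (rule filterlim_compose) (rule grid_index_tendsto[of \<tau> \<omega>, OF \<tau>0])
    then show ?case
      unfolding G_def by (rule isCont_tendsto_compose[OF isCont_gauss_bump])
  qed
  then have L_eq: "AE \<omega> in completion M. L \<omega> = gauss_bump (X (\<tau> \<omega>) \<omega>)"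
    by eventually_elim (simp add: L_def limI)
  have "integrable (completion M) L \<and> (\<lambda>n. \<integral>\<omega>. G n \<omega> \<partial>completion M) \<longlonglongrightarrow> (\<integral>\<omega>. L \<omega> \<partial>completion M)"
  proof
    have lim': "AE \<omega> in completion M. (\<lambda>n. G n \<omega>) \<longlonglongrightarrow> L \<omega>"
      using lim L_eq by eventually_elim simp
    have bd: "AE \<omega> in completion M. norm (G n \<omega>) \<le> 2" for n
      by (intro AE_I2) (simp add: G_def gauss_bump_bounds)
    show "integrable (completion M) L"
      by (rule integrable_dominated_convergence[OF L_meas G_meas _ lim' bd]) simp
    show "(\<lambda>n. \<integral>\<omega>. G n \<omega> \<partial>completion M) \<longlonglongrightarrow> (\<integral>\<omega>. L \<omega> \<partial>completion M)"
      by (rule integral_dominated_convergence[OF L_meas G_meas _ lim' bd]) simp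
  qed
  moreover have "(\<lambda>n. 1 - C * ((\<integral>\<omega>. \<tau> \<omega> \<partial>completion M) + 2 * inverse (real (Suc n)))) \<longlonglongrightarrow>
      1 - C * ((\<integral>\<omega>. \<tau> \<omega> \<partial>completion M) + 2 * 0)"
    by (intro tendsto_intros LIMSEQ_inverse_real_of_nat)
  moreover have "1 - C * ((\<integral>\<omega>. \<tau> \<omega> \<partial>completion M) + 2 * inverse (real (Suc n))) \<le> (\<integral>\<omega>. G n \<omega> \<partial>completion M)" for n
    using gauss_bump_grid(2)[OF C \<open>0 \<le> C\<close> \<tau>, of "Suc n"] unfolding G_def
    by (simp add: divide_inverse del: of_nat_Suc)
  ultimately have "1 - C * ((\<integral>\<omega>. \<tau> \<omega> \<partial>completion M) + 2 * 0) \<le> (\<integral>\<omega>. L \<omega> \<partial>completion M)"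
    by (intro LIMSEQ_le) auto
  then show thesis
    using that[of L] L_eq \<open>integrable (completion M) L \<and> _\<close> by simp
qed

section \<open>Bounds on the American put and the critical price\<close>

text \<open>Bounds the set whose supremum defines the put, so that the supremum is meaningful. A
  non-integrable payoff contributes the default value 0.\<close>

lemma american_put_integral_le:
  assumes "0 \<le> r" "0 < K" "0 \<le> x" "\<tau> \<in> stopping_times_upto M X s"
  shows "(\<integral>\<omega>. exp (- r * \<tau> \<omega>) * max 0 (K - x * exp ((r - \<delta>) * \<tau> \<omega> + X (\<tau> \<omega>) \<omega>)) \<partial>completion M) \<le> K"
    (is "integral\<^sup>L _ ?f \<le> K")
proof (cases "integrable (completion M) ?f")
  case True
  interpret cM: prob_space "completion M" by (rule prob_space_completion)
  show ?thesis
  proof (rule cM.integral_le_const[OF True AE_I2])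
    fix \<omega> assume "\<omega> \<in> space (completion M)"
    then have "0 \<le> \<tau> \<omega>" using assms(4) by (simp add: stopping_times_upto_def)
    then have "?f \<omega> \<le> 1 * K"
      using assms by (intro mult_mono) auto
    then show "?f \<omega> \<le> K" by simp
  qed
qed (use assms in \<open>simp add: not_integrable_integral_eq\<close>)

lemma const_stopping_time: "0 \<le> s \<Longrightarrow> (\<lambda>_. s) \<in> stopping_times_upto M X s"
proof -
  have "{\<omega> \<in> space M. s \<le> t} = (if s \<le> t then space M else {})" for t by auto
  moreover assume "0 \<le> s"
  ultimately show ?thesis
    by (simp add: stopping_times_upto_def usual_augmentation_def sigma_sets_top sigma_sets.Empty)
qed

lemma european_le_american_put:
  assumes "0 \<le> r" "0 < K" "0 \<le> x" "t \<le> T"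
  shows "exp (- r * (T - t)) * (\<integral>\<omega>. max 0 (K - x * exp ((r - \<delta>) * (T - t) + X (T - t) \<omega>)) \<partial>M)
    \<le> american_put M X r \<delta> K T t x"
proof -
  have "exp (- r * (T - t)) * (\<integral>\<omega>. max 0 (K - x * exp ((r - \<delta>) * (T - t) + X (T - t) \<omega>)) \<partial>M) =
    (\<integral>\<omega>. exp (- r * (T - t)) * max 0 (K - x * exp ((r - \<delta>) * (T - t) + X (T - t) \<omega>)) \<partial>completion M)"
    by (subst integral_completion) auto
  also have "\<dots> \<le> american_put M X r \<delta> K T t x"
    unfolding american_put_def
  proof (rule cSUP_upper2[OF _ _ order_refl])
    show "(\<lambda>_. T - t) \<in> stopping_times_upto M X (T - t)"
      using assms by (intro const_stopping_time) auto
  qed (intro bdd_aboveI2[where M = K] american_put_integral_le assms; assumption)+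
  finally show ?thesis .
qed

text \<open>Pointwise the discounted payoff is at most K - (K r/2 - 2 \<delta> x) \<tau> - x L.
  Taking expectations with the bound for the stopped bump leaves K - x - (K r/2 - x (C + 2
  \<delta>)) E \<tau>, and the bracket is nonnegative for small \<open>x\<close>.\<close>

lemma american_put_le_intrinsic:
  assumes r: "0 < r" and K: "0 < K" and \<delta>: "0 \<le> \<delta>"
  obtains x0 where "0 < x0" "\<And>T t x. t \<le> T \<Longrightarrow> r * (T - t) \<le> 1 \<Longrightarrow> 0 \<le> x \<Longrightarrow> x < x0 \<Longrightarrow>
    american_put M X r \<delta> K T t x \<le> K - x"
proof -
  interpret cM: prob_space "completion M" by (rule prob_space_completion)
  obtain C where C0: "C \<ge> 0" and C: "\<And>h y. 0 \<le> h \<Longrightarrow> (\<integral>\<omega>. gauss_bump (y + X h \<omega>) \<partial>M) \<ge> gauss_bump y - C * h"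
    using gauss_bump_one_step by auto
  \<comment> \<open>The bound K/6 keeps the pointwise majorant nonnegative; the other one gives x (C
    + 2 \<delta>) \<le> K r/2, where the summand 1 makes the denominator positive.\<close>
  define x0 where "x0 = min (K / 6) (K * r / (2 * (C + 2 * \<delta> + 1)))"
  have x0: "0 < x0"
    using r K \<delta> C0 by (simp add: x0_def)
  show thesis
  proof (rule that[OF x0])
    fix T t x assume t: "t \<le> T" "r * (T - t) \<le> 1" and x: "0 \<le> x" "x < x0"
    have xK: "x \<le> K / 6"
      using x by (simp add: x0_def)
    have xC: "x * (C + 2 * \<delta>) \<le> K * r / 2"
    proof -
      have "x * (C + 2 * \<delta> + 1) \<le> K * r / (2 * (C + 2 * \<delta> + 1)) * (C + 2 * \<delta> + 1)"
        using x \<delta> C0 by (intro mult_right_mono) (auto simp: x0_def)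
      also have "\<dots> = K * r / 2"
        using \<delta> C0 by (simp add: field_simps)
      finally show ?thesis using x by (simp add: algebra_simps)
    qed
    show "american_put M X r \<delta> K T t x \<le> K - x"
      unfolding american_put_def
    proof (rule cSUP_least)
      show "stopping_times_upto M X (T - t) \<noteq> {}"
        using const_stopping_time[of "T - t"] t by auto
    next
      fix \<tau> assume \<tau>: "\<tau> \<in> stopping_times_upto M X (T - t)"
      let ?f = "\<lambda>\<omega>. exp (- r * \<tau> \<omega>) * max 0 (K - x * exp ((r - \<delta>) * \<tau> \<omega> + X (\<tau> \<omega>) \<omega>))"
      show "integral\<^sup>L (completion M) ?f \<le> K - x"
      \<comment> \<open>A non-integrable payoff has integral 0, which is below K - x.\<close>
      proof (cases "integrable (completion M) ?f")
        case True
        have \<tau>_bd: "0 \<le> \<tau> \<omega>" "\<tau> \<omega> \<le> T - t" if "\<omega> \<in> space M" for \<omega>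
          using \<tau> that by (auto simp: stopping_times_upto_def)
        have [measurable]: "\<tau> \<in> borel_measurable (completion M)"
          by (rule stopping_time_measurable[OF \<tau>])
        have \<tau>_int: "integrable (completion M) \<tau>"
          by (rule cM.integrable_const_bound[where B = "T - t"]) (use \<tau>_bd in auto)
        obtain L where L: "integrable (completion M) L"
          "AE \<omega> in completion M. L \<omega> = gauss_bump (X (\<tau> \<omega>) \<omega>)"
          "1 - C * (\<integral>\<omega>. \<tau> \<omega> \<partial>completion M) \<le> (\<integral>\<omega>. L \<omega> \<partial>completion M)"
          using gauss_bump_stopped[OF C C0 \<tau>] by auto
        have "integral\<^sup>L (completion M) ?f \<le> (\<integral>\<omega>. K - (K * r / 2 - 2 * \<delta> * x) * \<tau> \<omega> - x * L \<omega> \<partial>completion M)"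
        proof (rule integral_mono_AE[OF True])
          show "integrable (completion M) (\<lambda>\<omega>. K - (K * r / 2 - 2 * \<delta> * x) * \<tau> \<omega> - x * L \<omega>)"
            using L(1) \<tau>_int by auto
          show "AE \<omega> in completion M. ?f \<omega> \<le> K - (K * r / 2 - 2 * \<delta> * x) * \<tau> \<omega> - x * L \<omega>"
            using L(2) AE_space
          proof eventually_elim
            case (elim \<omega>)
            define y where "y = X (\<tau> \<omega>) \<omega>"
            define v where "v = \<tau> \<omega>"
            have v: "0 \<le> v" "v \<le> T - t"
              using \<tau>_bd elim by (auto simp: v_def)
            have rv: "0 \<le> r * v" "r * v \<le> 1"
              using v(1) r order_trans[OF mult_left_mono[OF v(2)] t(2)] by auto
            have ev: "exp (- (r * v)) \<le> 1 - r * v / 2"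
              using one_minus_exp_ge[of 1 "- (r * v)"] rv by simp
            \<comment> \<open>Needed where the positive part of the payoff is 0: the interest term
              is at most K/2 and the bump term at most K/3.\<close>
            have nn: "0 \<le> K - (K * r / 2 - 2 * \<delta> * x) * v - x * gauss_bump y"
            proof -
              have "x * gauss_bump y \<le> K / 6 * 2"
                using xK x by (intro mult_mono gauss_bump_bounds) auto
              moreover have "K * (r * v) \<le> K"
                using mult_left_mono[OF rv(2), of K] K by simp
              moreover have "0 \<le> \<delta> * (x * v)"
                using \<delta> x v by simp
              moreover have "K - (K * r / 2 - 2 * \<delta> * x) * v - x * gauss_bump y =
                  K - K * (r * v) / 2 + 2 * (\<delta> * (x * v)) - x * gauss_bump y"
                by (simp add: algebra_simps)
              ultimately show ?thesis
                using K by linarith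
            qed
            \<comment> \<open>The dividend factor exp (-\<delta> v) costs at most 2 \<delta> v,
              because the bump is at most 2; the factor exp (-r v) saves at least r v/2, because r v
              \<le> 1.\<close>
            have pos: "exp (- (r * v)) * (K - x * exp ((r - \<delta>) * v + y)) \<le>
                K - (K * r / 2 - 2 * \<delta> * x) * v - x * gauss_bump y"
            proof -
              have "exp (- (\<delta> * v)) * exp y \<ge> exp (- (\<delta> * v)) * gauss_bump y"
                by (intro mult_left_mono gauss_bump_bounds) auto
              moreover have "exp (- (\<delta> * v)) * gauss_bump y \<ge> (1 - \<delta> * v) * gauss_bump y"
                using exp_ge_add_one_self[of "- (\<delta> * v)"] by (intro mult_right_mono gauss_bump_bounds) auto
              moreover have "\<delta> * v * gauss_bump y \<le> \<delta> * v * 2"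
                using \<delta> v by (intro mult_left_mono gauss_bump_bounds) auto
              moreover have "(1 - \<delta> * v) * gauss_bump y = gauss_bump y - \<delta> * v * gauss_bump y"
                by (simp add: left_diff_distrib)
              ultimately have "gauss_bump y - 2 * \<delta> * v \<le> exp (- (\<delta> * v)) * exp y"
                by linarith
              then have 1: "x * (gauss_bump y - 2 * \<delta> * v) \<le> x * (exp (- (\<delta> * v)) * exp y)"
                using x by (intro mult_left_mono)
              have 2: "K * exp (- (r * v)) \<le> K * (1 - r * v / 2)"
                using ev K by (intro mult_left_mono) auto
              have "exp (- (r * v)) * exp ((r - \<delta>) * v + y) = exp (- (\<delta> * v)) * exp y"
                unfolding exp_add[symmetric] by (simp add: algebra_simps)
              then have 3: "exp (- (r * v)) * (K - x * exp ((r - \<delta>) * v + y)) =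
                  K * exp (- (r * v)) - x * (exp (- (\<delta> * v)) * exp y)"
                by (simp add: algebra_simps)
              show ?thesis
                unfolding 3 using 1 2 by (simp add: algebra_simps)
            qed
            have "exp (- r * v) * max 0 (K - x * exp ((r - \<delta>) * v + y)) \<le>
                K - (K * r / 2 - 2 * \<delta> * x) * v - x * gauss_bump y"
              using nn pos by (auto simp: max_def)
            then show ?case
              using elim by (simp add: v_def y_def)
          qed
        qed
        also have "\<dots> = K - (K * r / 2 - 2 * \<delta> * x) * (\<integral>\<omega>. \<tau> \<omega> \<partial>completion M) - x * (\<integral>\<omega>. L \<omega> \<partial>completion M)"
          using L(1) \<tau>_int cM.prob_space by simp
        also have "\<dots> \<le> K - (K * r / 2 - 2 * \<delta> * x) * (\<integral>\<omega>. \<tau> \<omega> \<partial>completion M) - x * (1 - C * (\<integral>\<omega>. \<tau> \<omega> \<partial>completion M))"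
          using mult_left_mono[OF L(3) x(1)] by simp
        also have "\<dots> = K - x - (K * r / 2 - x * (C + 2 * \<delta>)) * (\<integral>\<omega>. \<tau> \<omega> \<partial>completion M)"
          by (simp add: algebra_simps)
        also have "\<dots> \<le> K - x"
          using xC \<tau>_bd by (auto intro!: mult_nonneg_nonneg integral_nonneg_AE)
        finally show ?thesis .
      qed (use xK K in \<open>simp add: not_integrable_integral_eq\<close>)
    qed
  qed
qed

end

section \<open>Squeezing the critical price and passing to the limit\<close>

theorem theorem6p1:
  fixes M :: "'a measure" and X :: "real \<Rightarrow> 'a \<Rightarrow> real"
    and \<sigma> \<gamma> :: real and \<nu> :: "real measure" and T K r \<delta> :: real
  assumes levy: "levy_process M X \<sigma> \<gamma> \<nu>"
    and T: "T > 0" and K: "K > 0" and r: "r > 0" and \<delta>: "\<delta> \<ge> 0"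
    and exp_moment: "(\<integral>\<^sup>+ x \<in> {x. 1 \<le> \<bar>x\<bar>}. ennreal (exp x) \<partial>\<nu>) < \<infinity>"
    and martingale: "\<sigma>\<^sup>2 / 2 + \<gamma> + (\<integral>x. exp x - 1 - x * indicator {-1..1} x \<partial>\<nu>) = 0"
    and nondeg: "\<sigma> \<noteq> 0 \<or> emeasure \<nu> {..<0} > 0 \<or> (\<integral>\<^sup>+ x \<in> {0<..}. ennreal (min x 1) \<partial>\<nu>) = \<infinity>"
    and inf_var: "\<sigma> \<noteq> 0 \<or> (\<integral>\<^sup>+ x \<in> {-1..1}. ennreal \<bar>x\<bar> \<partial>\<nu>) = \<infinity>"
    and dplus: "d_plus r \<delta> \<nu> \<ge> 0"
  shows "filterlim (\<lambda>t. (K / critical_price M X r \<delta> K T t - 1) / (T - t)) at_top (at_left T)"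
proof -
  interpret levy M X \<sigma> \<gamma> \<nu>
    by (rule levy.intro[OF levy])
  \<comment> \<open>An infinite integral would make d_+ equal to minus infinity.\<close>
  have up: "(\<integral>\<^sup>+ y. ennreal (max 0 (exp y - 1)) \<partial>\<nu>) < \<infinity>"
    using dplus by (auto simp: d_plus_def less_top[symmetric])
  obtain x0 where x0: "0 < x0" "\<And>T t x. t \<le> T \<Longrightarrow> r * (T - t) \<le> 1 \<Longrightarrow> 0 \<le> x \<Longrightarrow> x < x0 \<Longrightarrow>
      american_put M X r \<delta> K T t x \<le> K - x"
    using american_put_le_intrinsic[OF r K \<delta>] by blast
  have sub: "filterlim (\<lambda>t. T - t) (at_right 0) (at_left T)"
    unfolding filterlim_at
    by (auto simp: eventually_at_filter intro!: tendsto_eq_intros)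
  show ?thesis
    unfolding filterlim_at_top
  proof
    fix Z :: real
    define C where "C = max Z 1"
    have C: "0 < C" "Z \<le> C" by (auto simp: C_def)
    \<comment> \<open>The factor 3 offsets the discount: exp (-r s) \<ge> 1/3 once r s \<le>
      1.\<close>
    have "\<forall>\<^sub>F s in at_right 0. 3 * C * s < (\<integral>\<omega>. max 0 (1 - exp (r * s + X s \<omega>)) \<partial>M)"
      using r by (intro small_time_put inf_var up) auto
    moreover have "\<forall>\<^sub>F s in at_right 0. s < 1 / r" "\<forall>\<^sub>F s in at_right 0. 0 < (s::real)"
      using r by (auto simp: eventually_at_right[of 0 1] intro!: exI[of _ "1 / r"] simp: eventually_at_right_less)
    ultimately have "\<forall>\<^sub>F s in at_right 0. 3 * C * s < (\<integral>\<omega>. max 0 (1 - exp (r * s + X s \<omega>)) \<partial>M) \<and> s < 1 / r \<and> 0 < s"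
      by eventually_elim simp
    then have "\<forall>\<^sub>F t in at_left T. 3 * C * (T - t) < (\<integral>\<omega>. max 0 (1 - exp (r * (T - t) + X (T - t) \<omega>)) \<partial>M)
        \<and> T - t < 1 / r \<and> 0 < T - t"
      by (rule eventually_compose_filterlim[OF _ sub])
    then show "\<forall>\<^sub>F t in at_left T. Z \<le> (K / critical_price M X r \<delta> K T t - 1) / (T - t)"
    proof eventually_elim
      case (elim t)
      define s where "s = T - t"
      have s: "0 < s" "r * s \<le> 1" and E: "3 * C * s < (\<integral>\<omega>. max 0 (1 - exp (r * s + X s \<omega>)) \<partial>M)"
        using elim r by (auto simp: s_def field_simps)
      \<comment> \<open>The price with K/x - 1 = C s exactly; it remains to see that waiting is
        better than exercising at \<open>x\<close>, so that the critical price is at most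
        \<open>x\<close>.\<close>
      define x where "x = K / (1 + C * s)"
      have Cs: "0 < C * s" using C s by simp
      have xs: "x * (1 + C * s) = K"
        using Cs by (simp add: x_def)
      have x: "0 < x" "x \<le> K"
        using K Cs by (auto simp: x_def divide_le_eq)
      have "x * (C * s) \<le> K * (C * s)"
        using x Cs by (intro mult_right_mono) auto
      then have Kx: "K - x \<le> K * (C * s)"
        using xs by (simp add: distrib_left)
      let ?S = "{x. 0 \<le> x \<and> american_put M X r \<delta> K T t x > max 0 (K - x)}"
      have "x \<in> ?S"
      proof -
        have "exp (- (r * s)) \<ge> 1 / 3"
        proof -
          have "exp (r * s) \<le> exp 1" using s by simp
          also have "\<dots> \<le> (3::real)" by (rule exp_le)
          finally show ?thesis by (simp add: exp_minus field_simps)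
        qed
        then have "1 / 3 * (K * (3 * C * s)) \<le> exp (- (r * s)) * (K * (3 * C * s))"
          using K Cs by (intro mult_right_mono) auto
        also have "\<dots> < exp (- (r * s)) * (K * (\<integral>\<omega>. max 0 (1 - exp (r * s + X s \<omega>)) \<partial>M))"
          using E K by (intro mult_strict_left_mono) auto
        also have "\<dots> \<le> exp (- (r * s)) * (\<integral>\<omega>. max 0 (K - x * exp ((r - \<delta>) * s + X s \<omega>)) \<partial>M)"
        proof (rule mult_left_mono)
          have "K * (\<integral>\<omega>. max 0 (1 - exp (r * s + X s \<omega>)) \<partial>M) = (\<integral>\<omega>. K * max 0 (1 - exp (r * s + X s \<omega>)) \<partial>M)"
            by simp
          also have "\<dots> \<le> (\<integral>\<omega>. max 0 (K - x * exp ((r - \<delta>) * s + X s \<omega>)) \<partial>M)"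
          proof (rule integral_mono)
            show "integrable M (\<lambda>\<omega>. K * max 0 (1 - exp (r * s + X s \<omega>)))"
              by (intro integrable_mult_right integrable_X_bounded[where B = 1]) auto
            show "integrable M (\<lambda>\<omega>. max 0 (K - x * exp ((r - \<delta>) * s + X s \<omega>)))"
              by (rule integrable_X_bounded[where B = K]) (use x K in auto)
            fix \<omega>
            \<comment> \<open>Dropping the dividend yield and raising the initial price from
              \<open>x\<close> to \<open>K\<close> only lowers the put payoff, and leaves the
              expectation already estimated.\<close>
            have "(r - \<delta>) * s \<le> r * s"
              using \<delta> s by (intro mult_right_mono) auto
            then have "x * exp ((r - \<delta>) * s + X s \<omega>) \<le> K * exp (r * s + X s \<omega>)"
              using x K by (intro mult_mono) auto
            then have "max 0 (K - K * exp (r * s + X s \<omega>)) \<le> max 0 (K - x * exp ((r - \<delta>) * s + X s \<omega>))"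
              by (intro max.mono) auto
            moreover have "K * max 0 (1 - exp (r * s + X s \<omega>)) = max 0 (K - K * exp (r * s + X s \<omega>))"
              using K by (simp add: max_mult_distrib_left right_diff_distrib)
            ultimately show "K * max 0 (1 - exp (r * s + X s \<omega>)) \<le> max 0 (K - x * exp ((r - \<delta>) * s + X s \<omega>))"
              by simp
          qed
          finally show "K * (\<integral>\<omega>. max 0 (1 - exp (r * s + X s \<omega>)) \<partial>M) \<le> (\<integral>\<omega>. max 0 (K - x * exp ((r - \<delta>) * s + X s \<omega>)) \<partial>M)" .
        qed simp
        also have "\<dots> \<le> american_put M X r \<delta> K T t x"
          using european_le_american_put[of r K x t T \<delta>] r K x s by (simp add: s_def)
        finally show ?thesis
          using x Kx by simp
      qed
      then have b_le: "critical_price M X r \<delta> K T t \<le> x"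
        unfolding critical_price_def by (rule cInf_lower) (auto intro!: bdd_belowI[of _ 0])
      \<comment> \<open>A strictly positive lower bound, without which inverting b(t) \<le> x would
        fail; no price below \<open>x0\<close> belongs to the set.\<close>
      have b_ge: "x0 \<le> critical_price M X r \<delta> K T t"
        unfolding critical_price_def
      proof (rule cInf_greatest)
        fix y assume "y \<in> ?S"
        then show "x0 \<le> y"
          using x0(2)[of t T y] s by (force simp: s_def not_le[symmetric])
      qed (use \<open>x \<in> ?S\<close> in auto)
      have "1 + C * s = K / x"
        using K Cs by (simp add: x_def)
      also have "\<dots> \<le> K / critical_price M X r \<delta> K T t"
        using b_le b_ge x0(1) K by (intro divide_left_mono mult_pos_pos) auto
      finally have "C \<le> (K / critical_price M X r \<delta> K T t - 1) / s"
        using s by (simp add: field_simps)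
      then show ?case
        using C by (simp add: s_def)
    qed
  qed
qed

end
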